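(* Let $\mathcal{A}$ be a unital $C^*$-algebra, $\mathcal{B}$ a $C^*$-subalgebra of $\mathcal{A}$, and $\mathcal{E}:\mathcal{A}\to\mathcal{B}$ a tracial conditional expectation. Let $\rho\in\mathcal{A}$ be positive and let $(f,g)$ be a same monotonic pair of continuous real-valued functions defined on an interval containing the spectrum of $\rho$. Then for all self-adjoint $A,B\in\mathcal{A}$, \[ \big|\mathrm{Corr}_{\rho,\mathcal{E}}^{\prime f,g}(A,B)\big|^2=\big|\mathrm{Re}\big(\mathrm{Corr}_{\rho,\mathcal{E}}^{f,g}(A,B)\big)\big|^2\ \le\ \mathrm{I}_{\rho,\mathcal{E}}^{f,g}(A)\,\mathrm{I}_{\rho,\mathcal{E}}^{f,g}(B). \] In particular, if $f=g$, then $\big|\mathrm{Corr}_{\rho,\mathcal{E}}^{\prime f,g}(A,B)\big|^2\le \mathrm{I}_{\rho,\mathcal{E}}^{f,g}(A)\,\mathrm{I}_{\rho,\mathcal{E}}^{f,g}(B)$ holds for all normal $A,B\in\mathcal{A}$.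
   Context: A conditional expectation $\mathcal{E}:\mathcal{A}\to\mathcal{B}$ onto a $C^*$-subalgebra $\mathcal{B}$ is a contractive positive linear map with $\mathcal{E}(BXC)=B\mathcal{E}(X)C$ for all $X\in\mathcal{A}$, $B,C\in\mathcal{B}$; it is tracial if $\mathcal{E}(XY)=\mathcal{E}(YX)$ for all $X,Y\in\mathcal{A}$. A pair $(f,g)$ of real-valued functions on a set $D$ is same monotonic if $(f(x)-f(y))(g(x)-g(y))\ge 0$ for all $x,y\in D$. $\mathrm{Re}(X):=(X+X^* )/2$, $|X|^2:=X^*X$. The generalized correlation is $\mathrm{Corr}_{\rho,\mathcal{E}}^{f,g}(A,B):=\mathcal{E}(f(\rho)g(\rho)A^*B)-\mathcal{E}(f(\rho)A^*g(\rho)B)$, the generalized skew information is $\mathrm{I}_{\rho,\mathcal{E}}^{f,g}(A):=\mathrm{Corr}_{\rho,\mathcal{E}}^{f,g}(A,A)$, and the generalized symmetric correlation is $\mathrm{Corr}_{\rho,\mathcal{E}}^{\prime f,g}(A,B):=\tfrac12\big(\mathrm{Corr}_{\rho,\mathcal{E}}^{f,g}(A,B)+\mathrm{Corr}_{\rho,\mathcal{E}}^{f,g}(B^*,A^* )\big)$. *)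

theory Defs
  imports Complex_Main "HOL-Analysis.Analysis" "HOL-Computational_Algebra.Polynomial"
begin

class cstar_algebra = real_normed_algebra_1 + banach +
  fixes cscale :: "complex \<Rightarrow> 'a \<Rightarrow> 'a"
    and adj :: "'a \<Rightarrow> 'a"
  assumes cscale_of_real: "cscale (complex_of_real r) x = scaleR r x"
    and cscale_add_left: "cscale (a + b) x = cscale a x + cscale b x"
    and cscale_add_right: "cscale a (x + y) = cscale a x + cscale a y"
    and cscale_cscale: "cscale a (cscale b x) = cscale (a * b) x"
    and cscale_mult_left: "cscale a (x * y) = cscale a x * y"
    and cscale_mult_right: "cscale a (x * y) = x * cscale a y"
    and norm_cscale: "norm (cscale a x) = cmod a * norm x"
    and adj_adj: "adj (adj x) = x"
    and adj_add: "adj (x + y) = adj x + adj y"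
    and adj_cscale: "adj (cscale a x) = cscale (cnj a) (adj x)"
    and adj_mult: "adj (x * y) = adj y * adj x"
    and cstar_identity: "norm (adj x * x) = (norm x)\<^sup>2"

definition selfadjoint :: "'a::cstar_algebra \<Rightarrow> bool" where
  "selfadjoint x \<longleftrightarrow> adj x = x"

definition normal_elem :: "'a::cstar_algebra \<Rightarrow> bool" where
  "normal_elem x \<longleftrightarrow> adj x * x = x * adj x"

definition positive_elem :: "'a::cstar_algebra \<Rightarrow> bool" where
  "positive_elem x \<longleftrightarrow> (\<exists>y. x = adj y * y)"

definition cle :: "'a::cstar_algebra \<Rightarrow> 'a \<Rightarrow> bool" where
  "cle x y \<longleftrightarrow> positive_elem (y - x)"

definition cinvertible :: "'a::cstar_algebra \<Rightarrow> bool" where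
  "cinvertible x \<longleftrightarrow> (\<exists>y. x * y = 1 \<and> y * x = 1)"

definition cspectrum :: "'a::cstar_algebra \<Rightarrow> complex set" where
  "cspectrum x = {c. \<not> cinvertible (x - cscale c 1)}"

definition creal :: "'a::cstar_algebra \<Rightarrow> 'a" where
  "creal X = scaleR (1/2) (X + adj X)"

definition cabs2 :: "'a::cstar_algebra \<Rightarrow> 'a" where
  "cabs2 X = adj X * X"

definition cstar_subalgebra :: "'a::cstar_algebra set \<Rightarrow> bool" where
  "cstar_subalgebra B \<longleftrightarrow> 0 \<in> B \<and> closed B \<and>
     (\<forall>x\<in>B. \<forall>y\<in>B. x + y \<in> B \<and> x * y \<in> B) \<and>
     (\<forall>x\<in>B. \<forall>c. cscale c x \<in> B) \<and> (\<forall>x\<in>B. adj x \<in> B)"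

definition cond_exp :: "('a::cstar_algebra \<Rightarrow> 'a) \<Rightarrow> 'a set \<Rightarrow> bool" where
  "cond_exp E B \<longleftrightarrow>
     range E = B \<and>
     (\<forall>x y. E (x + y) = E x + E y) \<and> (\<forall>c x. E (cscale c x) = cscale c (E x)) \<and>
     (\<forall>x. norm (E x) \<le> norm x) \<and>
     (\<forall>x. positive_elem x \<longrightarrow> positive_elem (E x)) \<and>
     (\<forall>X. \<forall>b\<in>B. \<forall>c\<in>B. E (b * X * c) = b * E X * c)"

definition tracial :: "('a::cstar_algebra \<Rightarrow> 'a) \<Rightarrow> bool" where
  "tracial E \<longleftrightarrow> (\<forall>X Y. E (X * Y) = E (Y * X))"

definition same_monotonic :: "('b \<Rightarrow> real) \<Rightarrow> ('b \<Rightarrow> real) \<Rightarrow> 'b set \<Rightarrow> bool" where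
  "same_monotonic f g D \<longleftrightarrow> (\<forall>x\<in>D. \<forall>y\<in>D. (f x - f y) * (g x - g y) \<ge> 0)"

definition peval :: "real poly \<Rightarrow> 'a::cstar_algebra \<Rightarrow> 'a" where
  "peval p x = (\<Sum>i\<le>degree p. scaleR (coeff p i) (x ^ i))"

text \<open>f(x) for a self-adjoint x and f continuous on (a neighbourhood in R of) the spectrum:
the limit of p_n(x) for any sequence of real polynomials p_n converging uniformly to f
on the spectrum of x.\<close>
definition cfc :: "(real \<Rightarrow> real) \<Rightarrow> 'a::cstar_algebra \<Rightarrow> 'a" where
  "cfc f x = (THE y. \<forall>P :: nat \<Rightarrow> real poly.
      uniform_limit {t. complex_of_real t \<in> cspectrum x} (\<lambda>n t. poly (P n) t) f sequentially
      \<longrightarrow> (\<lambda>n. peval (P n) x) \<longlonglongrightarrow> y)"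

definition Corr :: "(real \<Rightarrow> real) \<Rightarrow> (real \<Rightarrow> real) \<Rightarrow> 'a::cstar_algebra \<Rightarrow> ('a \<Rightarrow> 'a)
    \<Rightarrow> 'a \<Rightarrow> 'a \<Rightarrow> 'a" where
  "Corr f g \<rho> E A B = E (cfc f \<rho> * cfc g \<rho> * adj A * B) - E (cfc f \<rho> * adj A * cfc g \<rho> * B)"

definition SkewI :: "(real \<Rightarrow> real) \<Rightarrow> (real \<Rightarrow> real) \<Rightarrow> 'a::cstar_algebra \<Rightarrow> ('a \<Rightarrow> 'a)
    \<Rightarrow> 'a \<Rightarrow> 'a" where
  "SkewI f g \<rho> E A = Corr f g \<rho> E A A"

definition SymCorr :: "(real \<Rightarrow> real) \<Rightarrow> (real \<Rightarrow> real) \<Rightarrow> 'a::cstar_algebra \<Rightarrow> ('a \<Rightarrow> 'a)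
    \<Rightarrow> 'a \<Rightarrow> 'a \<Rightarrow> 'a" where
  "SymCorr f g \<rho> E A B = scaleR (1/2) (Corr f g \<rho> E A B + Corr f g \<rho> E (adj B) (adj A))"

end

theory Submission
  imports Defs "HOL-Computational_Algebra.Fundamental_Theorem_Algebra"
begin

text \<open>Replacing \<open>f(\<rho>)\<close> and \<open>g(\<rho>)\<close> by Bernstein approximants \<open>\<Sum>\<^sub>k f(t\<^sub>k) u\<^sub>k\<close>, with \<open>u\<^sub>k \<ge> 0\<close> and
  \<open>\<Sum>\<^sub>k u\<^sub>k = 1\<close>, traciality turns the symmetric correlation into
  \<open>1/2 \<Sum>\<^sub>k\<^sub>l (f(t\<^sub>k) - f(t\<^sub>l)) (g(t\<^sub>k) - g(t\<^sub>l)) \<E>(u\<^sub>k A\<^sup>* u\<^sub>l B)\<close>, a positive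
  sesquilinear form. Traciality also forces \<open>\<B>\<close> to be commutative and \<open>\<E>\<close> to be \<open>\<B>\<close>-linear,
  so the form satisfies a \<open>\<B>\<close>-valued Cauchy--Schwarz inequality. The skew information is its
  diagonal when \<open>A\<close> is self-adjoint, or normal with \<open>f = g\<close>.\<close>

section \<open>Elementary facts and square roots\<close>

text \<open>Bernstein approximation is used because it only samples f and g: the coefficients are
  values at common nodes, so same monotonicity survives, which it need not for arbitrary
  approximating polynomials. The price is that nodes can leave the spectrum, hence the extension of
  f and g to the whole line. Two obstacles shape the rest. First, \<open>positive_elem\<close>
  offers no closure properties, and \<open>cfc\<close> has a definite value only once p(x) is
  controlled by p on the spectrum. Both problems reduce to a square root of 1 - h for self-adjoint h
  of norm at most 1. Second, B need not contain the unit of the ambient algebra, so the bimodule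
  rule cannot be made one-sided by setting a factor to 1. Multiplying a defect by its own adjoint
  and cancelling with the C*-identity takes the place of this.\<close>

lemma adj_zero [simp]: "adj (0::'a::cstar_algebra) = 0"
  using adj_add[of "0::'a" 0] by simp

lemma adj_minus [simp]: "adj (- x) = - adj (x::'a::cstar_algebra)"
  using adj_add[of x "- x"] by (simp add: eq_neg_iff_add_eq_0 add.commute)

lemma adj_diff: "adj (x - y) = adj x - adj (y::'a::cstar_algebra)"
  using adj_add[of x "- y"] by simp

lemma adj_scaleR [simp]: "adj (scaleR r x) = scaleR r (adj (x::'a::cstar_algebra))"
  by (metis adj_cscale complex_cnj_complex_of_real cscale_of_real)

lemma adj_one [simp]: "adj (1::'a::cstar_algebra) = 1"
  by (metis adj_adj adj_mult mult_1_right)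

lemma norm_adj [simp]: "norm (adj x) = norm (x::'a::cstar_algebra)"
proof -
  have le: "norm x \<le> norm (adj x)" for x :: 'a
  proof (cases "x = 0")
    case False
    have "norm x * norm x \<le> norm (adj x) * norm x"
      using norm_mult_ineq[of "adj x" x] by (simp add: cstar_identity power2_eq_square)
    then show ?thesis using False by simp
  qed simp
  show ?thesis using le[of x] le[of "adj x"] by (simp add: adj_adj)
qed

lemma bounded_linear_adj: "bounded_linear (adj :: 'a::cstar_algebra \<Rightarrow> 'a)"
  by (rule bounded_linear_intro[where K = 1]) (simp_all add: adj_add)

lemmas tendsto_adj [tendsto_intros] = bounded_linear.tendsto[OF bounded_linear_adj]

lemma selfadjoint_arith [simp]:
  fixes x y :: "'a::cstar_algebra"
  shows "selfadjoint (0::'a)" "selfadjoint (1::'a)"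
    "selfadjoint x \<Longrightarrow> selfadjoint y \<Longrightarrow> selfadjoint (x + y)"
    "selfadjoint x \<Longrightarrow> selfadjoint y \<Longrightarrow> selfadjoint (x - y)"
    "selfadjoint x \<Longrightarrow> selfadjoint (- x)"
    "selfadjoint x \<Longrightarrow> selfadjoint (scaleR r x)"
    "selfadjoint x \<Longrightarrow> selfadjoint (x * x)"
  by (simp_all add: selfadjoint_def adj_add adj_diff adj_mult)

lemma selfadjoint_mult:
  "selfadjoint x \<Longrightarrow> selfadjoint y \<Longrightarrow> x * y = y * x \<Longrightarrow> selfadjoint (x * y)"
  by (simp add: selfadjoint_def adj_mult)

lemma selfadjoint_adj_mult [simp]: "selfadjoint (adj x * x)"
  by (simp add: selfadjoint_def adj_mult adj_adj)

lemma selfadjoint_lim: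
  assumes "X \<longlonglongrightarrow> L" "\<And>n. selfadjoint (X n)"
  shows "selfadjoint L"
proof -
  have "(\<lambda>n. adj (X n)) \<longlonglongrightarrow> adj L" by (intro tendsto_intros assms)
  then have "X \<longlonglongrightarrow> adj L" using assms(2) by (simp add: selfadjoint_def)
  then show ?thesis using assms(1) LIMSEQ_unique by (auto simp: selfadjoint_def)
qed

lemma norm_selfadjoint_square:
  "selfadjoint a \<Longrightarrow> norm (a * a) = (norm (a::'a::cstar_algebra))\<^sup>2"
  using cstar_identity[of a] by (simp add: selfadjoint_def)

lemma cscale_zero [simp]: "cscale c (0::'a::cstar_algebra) = 0"
  using cscale_add_right[of c "0::'a" 0] by simp

lemma cscale_one [simp]: "cscale 1 (x::'a::cstar_algebra) = x"
  using cscale_of_real[of 1 x] by simp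

lemma cscale_minus_one [simp]: "cscale (- 1) (x::'a::cstar_algebra) = - x"
  using cscale_of_real[of "- 1" x] by simp

lemma cscale_minus_right: "cscale c (- x) = - cscale c (x::'a::cstar_algebra)"
  using cscale_add_right[of c x "- x"] by (simp add: eq_neg_iff_add_eq_0 add.commute)

lemma cscale_minus_left: "cscale (- c) x = - cscale c (x::'a::cstar_algebra)"
  using cscale_cscale[of "-1" c x] by simp

lemma cartesian_decomposition:
  fixes x :: "'a::cstar_algebra"
  obtains a b where "selfadjoint a" "selfadjoint b" "x = a + cscale \<i> b"
    "adj x = a - cscale \<i> b"
proof
  define a where "a = scaleR (1/2) (x + adj x)"
  define b where "b = cscale (- \<i>) (scaleR (1/2) (x - adj x))"
  have ib: "cscale \<i> b = scaleR (1/2) (x - adj x)"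
    by (simp add: b_def cscale_cscale)
  show "selfadjoint a" by (simp add: a_def selfadjoint_def adj_add adj_adj add.commute)
  have "adj b = cscale \<i> (scaleR (1/2) (adj x - x))"
    by (simp add: b_def adj_cscale adj_diff adj_adj)
  also have "\<dots> = b"
    using cscale_minus_right[of \<i> "scaleR (1/2) (x - adj x)"]
    by (simp add: b_def cscale_minus_left flip: scaleR_minus_right)
  finally show "selfadjoint b" by (simp add: selfadjoint_def)
  show "x = a + cscale \<i> b" "adj x = a - cscale \<i> b"
    by (simp_all add: ib, simp_all add: a_def flip: scaleR_add_right scaleR_diff_right)
qed

text \<open>The two products differ only in the sign of the commutator term. It vanishes when a and
  b commute, and it cancels in the sum of the products; both effects are used.\<close>

lemma cartesian_squares:
  fixes a b :: "'a::cstar_algebra"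
  assumes "selfadjoint a" "selfadjoint b"
  defines "z \<equiv> a + cscale \<i> b"
  shows "adj z = a - cscale \<i> b"
    and "adj z * z = a * a + b * b + cscale \<i> (a * b - b * a)"
    and "z * adj z = a * a + b * b - cscale \<i> (a * b - b * a)"
proof -
  show az: "adj z = a - cscale \<i> b"
    using assms by (simp add: z_def adj_add adj_cscale selfadjoint_def cscale_minus_left)
  have d: "cscale \<i> (x - y) = cscale \<i> x - cscale \<i> y" for x y :: 'a
    using cscale_add_right[of \<i> x "- y"] by (simp add: cscale_minus_right)
  have m: "x * cscale c y = cscale c (x * y)" "cscale c x * y = cscale c (x * y)" for c and x y :: 'a
    by (metis cscale_mult_right, metis cscale_mult_left)
  show "adj z * z = a * a + b * b + cscale \<i> (a * b - b * a)"
    and "z * adj z = a * a + b * b - cscale \<i> (a * b - b * a)"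
    unfolding az by (simp_all add: z_def algebra_simps m cscale_cscale d cscale_minus_left
        cscale_add_right)
qed

text \<open>Since a is the real part of z = a + i b, norm a is at most norm z, and for commuting a
  and b the C*-identity reads off norm z from a^2 + b^2. This is norm monotonicity before any order
  is available.\<close>

lemma norm_square_le_sum_squares:
  fixes a b :: "'a::cstar_algebra"
  assumes "selfadjoint a" "selfadjoint b" "a * b = b * a"
  shows "norm (a * a) \<le> norm (a * a + b * b)"
proof -
  define z where "z = a + cscale \<i> b"
  note z = cartesian_squares[OF assms(1,2), folded z_def]
  have "z + adj z = scaleR 2 a" using z(1) by (simp add: z_def scaleR_2)
  then have "2 * norm a = norm (z + adj z)" by simp
  also have "\<dots> \<le> 2 * norm z" using norm_triangle_ineq[of z "adj z"] by simp
  finally have "(norm a)\<^sup>2 \<le> (norm z)\<^sup>2" by simp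
  then show ?thesis
    using z(2) assms by (simp add: norm_selfadjoint_square flip: cstar_identity)
qed

text \<open>A Banach-algebra version of the monotone iteration \<open>b \<mapsto> (h + b\<^sup>2) / 2\<close>, whose increments are
  dominated by those of the scalar iteration with \<open>h = 1\<close>.\<close>

lemma square_root_exists:
  fixes h :: "'a::cstar_algebra"
  assumes h: "selfadjoint h" "norm h \<le> 1"
  obtains s where "selfadjoint s" "s * s = 1 - h" "\<And>c. c * h = h * c \<Longrightarrow> c * s = s * c"
proof -
  define b where "b = rec_nat 0 (\<lambda>_ y. scaleR (1/2) (h + y * y))"
  have b0: "b 0 = 0" and bS: "b (Suc n) = scaleR (1/2) (h + b n * b n)" for n
    by (simp_all add: b_def)
  define \<beta> where "\<beta> = rec_nat (0::real) (\<lambda>_ y. (1 + y * y) / 2)"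
  have \<beta>0: "\<beta> 0 = 0" and \<beta>S: "\<beta> (Suc n) = (1 + \<beta> n * \<beta> n) / 2" for n
    by (simp_all add: \<beta>_def)
  have comm: "c * b n = b n * c" if "c * h = h * c" for c n
  proof (induction n)
    case (Suc n)
    have "c * (b n * b n) = (b n * b n) * c" by (metis Suc mult.assoc)
    then show ?case using that by (simp add: bS algebra_simps)
  qed (simp add: b0)
  have "h * b n = b n * h" for n by (rule comm) simp
  then have bb: "b m * b n = b n * b m" for m n by (rule comm[OF sym])
  have sa: "selfadjoint (b n)" for n by (induction n) (simp_all add: b0 bS h)
  have \<beta>01: "0 \<le> \<beta> n \<and> \<beta> n \<le> 1" for n
  proof (induction n)
    case (Suc n)
    then have "\<beta> n * \<beta> n \<le> 1" by (simp add: mult_le_one)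
    then show ?case by (simp add: \<beta>S)
  qed (simp add: \<beta>0)
  have nb: "norm (b n) \<le> \<beta> n" for n
  proof (induction n)
    case (Suc n)
    have "norm (b n * b n) \<le> \<beta> n * \<beta> n"
      using norm_mult_ineq[of "b n" "b n"] mult_mono[OF Suc Suc] \<beta>01[of n] by simp
    then have "norm (h + b n * b n) \<le> 1 + \<beta> n * \<beta> n"
      using norm_triangle_ineq[of h "b n * b n"] h(2) by linarith
    then show ?case by (simp add: bS \<beta>S)
  qed (simp add: b0 \<beta>0)
  have step: "norm (b (Suc n) - b n) \<le> \<beta> (Suc n) - \<beta> n" for n
  proof (induction n)
    case 0
    then show ?case using h by (simp add: b0 bS \<beta>0 \<beta>S)
  next
    case (Suc n)
    have "b (Suc (Suc n)) - b (Suc n)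
        = scaleR (1/2) (h + b (Suc n) * b (Suc n)) - scaleR (1/2) (h + b n * b n)"
      by (simp only: bS)
    also have "\<dots> = scaleR (1/2) ((b (Suc n) - b n) * (b (Suc n) + b n))"
      using bb[of n "Suc n"] by (simp add: algebra_simps)
    finally have "norm (b (Suc (Suc n)) - b (Suc n)) =
        norm ((b (Suc n) - b n) * (b (Suc n) + b n)) / 2" by simp
    also have "\<dots> \<le> norm (b (Suc n) - b n) * norm (b (Suc n) + b n) / 2"
      by (simp add: norm_mult_ineq)
    also have "\<dots> \<le> (\<beta> (Suc n) - \<beta> n) * (\<beta> (Suc n) + \<beta> n) / 2"
      using norm_triangle_ineq[of "b (Suc n)" "b n"] nb[of n] nb[of "Suc n"]
      by (intro divide_right_mono mult_mono Suc)
         (use Suc order_trans[OF norm_ge_zero Suc] in auto)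
    also have "\<dots> = \<beta> (Suc (Suc n)) - \<beta> (Suc n)"
      by (simp add: \<beta>S[of "Suc n"] field_simps) (simp add: \<beta>S field_simps)
    finally show ?case .
  qed
  have incr: "norm (b (n + k) - b n) \<le> \<beta> (n + k) - \<beta> n" for n k
  proof (induction k)
    case (Suc k)
    have "norm (b (Suc (n + k)) - b n) \<le> norm (b (Suc (n + k)) - b (n + k)) + norm (b (n + k) - b n)"
      using norm_triangle_ineq[of "b (Suc (n + k)) - b (n + k)" "b (n + k) - b n"] by simp
    then show ?case using Suc step[of "n + k"] by simp
  qed simp
  have "incseq \<beta>"
    by (rule incseq_SucI) (meson diff_ge_0_iff_ge norm_ge_zero order_trans step)
  then obtain l where "\<beta> \<longlonglongrightarrow> l" using incseq_convergent[of \<beta> 1] \<beta>01 by metis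
  then have C\<beta>: "Cauchy \<beta>" by (rule LIMSEQ_imp_Cauchy)
  have "Cauchy b"
  proof (rule CauchyI')
    fix e :: real assume "e > 0"
    then obtain M where M: "\<And>m n. m \<ge> M \<Longrightarrow> n \<ge> M \<Longrightarrow> norm (\<beta> m - \<beta> n) < e"
      using CauchyD[OF C\<beta>] by blast
    have "dist (b m) (b n) < e" if "m \<ge> M" "n > m" for m n
    proof -
      have "norm (b n - b m) \<le> \<beta> n - \<beta> m" using incr[of m "n - m"] that by simp
      then show ?thesis using M[of n m] that by (simp add: dist_norm norm_minus_commute)
    qed
    then show "\<exists>M. \<forall>m\<ge>M. \<forall>n>m. dist (b m) (b n) < e" by blast
  qed
  then obtain y where y: "b \<longlonglongrightarrow> y" using Cauchy_convergent convergentD by blast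
  have "(\<lambda>n. b (Suc n)) \<longlonglongrightarrow> scaleR (1/2) (h + y * y)"
    unfolding bS by (intro tendsto_intros y)
  then have yy: "y = scaleR (1/2) (h + y * y)"
    using LIMSEQ_Suc[OF y] LIMSEQ_unique by blast
  have "scaleR 2 y = scaleR 2 (scaleR (1/2) (h + y * y))" using yy by (rule arg_cong)
  then have "scaleR 2 y = h + y * y" by simp
  \<comment> \<open>The fixed point equation 2 y = h + y^2 completes to this square, so the root is
    1 - y.\<close>
  then have "(1 - y) * (1 - y) = 1 - h" by (simp add: algebra_simps scaleR_2)
  moreover have "c * (1 - y) = (1 - y) * c" if "c * h = h * c" for c
  proof -
    have "(\<lambda>n. c * b n) \<longlonglongrightarrow> c * y" "(\<lambda>n. b n * c) \<longlonglongrightarrow> y * c"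
      by (intro tendsto_intros y)+
    then have "c * y = y * c" using comm[OF that] LIMSEQ_unique by auto
    then show ?thesis by (simp add: algebra_simps)
  qed
  moreover have "selfadjoint (1 - y)" using selfadjoint_lim[OF y sa] by simp
  ultimately show ?thesis using that by blast
qed

section \<open>Positive elements and invertibility\<close>

lemma square_complement:
  fixes a :: "'a::cstar_algebra"
  assumes a: "selfadjoint a" "norm (a * a) \<le> N"
  obtains r where "selfadjoint r" "scaleR N 1 - a * a = r * r"
    "\<And>c. c * (a * a) = (a * a) * c \<Longrightarrow> c * r = r * c"
proof (cases "N = 0")
  case True
  then show ?thesis using that[of 0] a by simp
next
  case False
  then have N: "N > 0" using a(2) norm_ge_zero[of "a * a"] by linarith
  define h where "h = scaleR (1/N) (a * a)"
  have h: "selfadjoint h" "norm h \<le> 1" using a N by (simp_all add: h_def)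
  obtain s where s: "selfadjoint s" "s * s = 1 - h" "\<And>c. c * h = h * c \<Longrightarrow> c * s = s * c"
    using square_root_exists[OF h] by metis
  show ?thesis
  proof (rule that[of "scaleR (sqrt N) s"])
    show "selfadjoint (scaleR (sqrt N) s)" using s(1) by simp
    show "scaleR N 1 - a * a = scaleR (sqrt N) s * scaleR (sqrt N) s"
      using s(2) N by (simp add: h_def scaleR_diff_right)
    fix c assume "c * (a * a) = (a * a) * c"
    then have "c * h = h * c" by (simp add: h_def)
    then have "c * s = s * c" by (rule s(3))
    then show "c * scaleR (sqrt N) s = scaleR (sqrt N) s * c" by simp
  qed
qed

text \<open>Write N - a^2 = r^2 with r commuting with a. The commuting squares r^2 and a^2 add up to
  N, so r^2 has norm at most N.\<close>

lemma norm_square_complement: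
  fixes a :: "'a::cstar_algebra"
  assumes a: "selfadjoint a" "norm (a * a) \<le> N"
  shows "norm (scaleR N 1 - a * a) \<le> N"
proof -
  obtain r where r: "selfadjoint r" "scaleR N 1 - a * a = r * r"
    "\<And>c. c * (a * a) = (a * a) * c \<Longrightarrow> c * r = r * c"
    using square_complement[OF a] by metis
  have "a * r = r * a" by (rule r(3)) (simp add: mult.assoc)
  then have "norm (r * r) \<le> norm (r * r + a * a)"
    by (intro norm_square_le_sum_squares r(1) a(1)) simp
  also have "r * r + a * a = scaleR N 1" using r(2) by (simp add: algebra_simps)
  finally show ?thesis using r(2) a(2) order_trans[OF norm_ge_zero a(2)] by simp
qed

text \<open>Squares of self-adjoint elements. Unlike for \<^const>\<open>positive_elem\<close>, closure under sums and
  limits follows at once from the norm characterization; the two notions coincide by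
  \<open>positive_elem_iff_sa_square\<close> below.\<close>

definition sa_square :: "'a::cstar_algebra \<Rightarrow> bool" where
  "sa_square x \<longleftrightarrow> (\<exists>a. selfadjoint a \<and> x = a * a)"

lemma sa_square_selfadjoint: "sa_square x \<Longrightarrow> selfadjoint x"
  by (auto simp: sa_square_def)

text \<open>For N > 0 the element h = 1 - x/N has norm at most 1, and x/N = 1 - h has a square root.
  Together with \<open>sa_square_norm_le\<close> this trades positivity for a norm
  inequality.\<close>

lemma sa_squareI_norm:
  fixes x :: "'a::cstar_algebra"
  assumes x: "selfadjoint x" "norm (scaleR N 1 - x) \<le> N"
  obtains a where "selfadjoint a" "x = a * a" "\<And>c. c * x = x * c \<Longrightarrow> c * a = a * c"
proof (cases "N = 0")
  case True
  then show ?thesis using that[of 0] x by simp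
next
  case False
  then have N: "N > 0" using x(2) norm_ge_zero[of "scaleR N 1 - x"] by linarith
  define h where "h = 1 - scaleR (1/N) x"
  have hN: "h = scaleR (1/N) (scaleR N 1 - x)" using N by (simp add: h_def algebra_simps)
  have sh: "selfadjoint h" using x by (simp add: h_def)
  have "norm h = norm (scaleR N 1 - x) / N" using N unfolding hN norm_scaleR by simp
  then have nh: "norm h \<le> 1" using N x(2) by simp
  obtain s where s: "selfadjoint s" "s * s = 1 - h" "\<And>c. c * h = h * c \<Longrightarrow> c * s = s * c"
    using square_root_exists[OF sh nh] by metis
  show ?thesis
  proof (rule that[of "scaleR (sqrt N) s"])
    show "selfadjoint (scaleR (sqrt N) s)" using s(1) by simp
    show "x = scaleR (sqrt N) s * scaleR (sqrt N) s"
      using s(2) N by (simp add: h_def)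
    fix c assume "c * x = x * c"
    then have "c * h = h * c" by (simp add: h_def algebra_simps)
    then have "c * s = s * c" by (rule s(3))
    then show "c * scaleR (sqrt N) s = scaleR (sqrt N) s * c" by simp
  qed
qed

lemma sa_square_norm_le:
  "sa_square x \<Longrightarrow> norm x \<le> N \<Longrightarrow> norm (scaleR N 1 - x) \<le> N"
  by (auto simp: sa_square_def norm_square_complement)

lemma sa_square_iff_norm:
  fixes x :: "'a::cstar_algebra"
  shows "sa_square x \<longleftrightarrow> selfadjoint x \<and> (\<exists>N. norm (scaleR N 1 - x) \<le> N)"
  using sa_squareI_norm[of x] sa_square_norm_le[of x "norm x"] sa_square_selfadjoint[of x]
  by (metis order_refl sa_square_def)

lemma sa_square_root:
  fixes x :: "'a::cstar_algebra"
  assumes "sa_square x"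
  obtains a where "selfadjoint a" "x = a * a" "\<And>c. c * x = x * c \<Longrightarrow> c * a = a * c"
  using sa_squareI_norm[of x] assms sa_square_iff_norm[of x] by metis

lemma sa_square_add:
  fixes x y :: "'a::cstar_algebra"
  assumes "sa_square x" "sa_square y"
  shows "sa_square (x + y)"
proof -
  obtain M N where "norm (scaleR M 1 - x) \<le> M" "norm (scaleR N 1 - y) \<le> N"
    using assms by (auto simp: sa_square_iff_norm)
  then have "norm (scaleR (M + N) 1 - (x + y)) \<le> M + N"
    using norm_triangle_ineq[of "scaleR M 1 - x" "scaleR N 1 - y"]
    by (simp add: algebra_simps)
  then show ?thesis using assms by (auto simp: sa_square_iff_norm)
qed

lemma sa_square_zero [simp]: "sa_square 0"
  unfolding sa_square_def by (rule exI[of _ 0]) simp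

lemma sa_square_one [simp]: "sa_square 1"
  unfolding sa_square_def by (rule exI[of _ 1]) simp

lemma sa_square_scaleR:
  assumes "0 \<le> r" "sa_square x" shows "sa_square (scaleR r x)"
proof -
  obtain a where "selfadjoint a" "x = a * a" using assms by (auto simp: sa_square_def)
  then have "selfadjoint (scaleR (sqrt r) a)" "scaleR r x = scaleR (sqrt r) a * scaleR (sqrt r) a"
    using assms by simp_all
  then show ?thesis by (auto simp: sa_square_def)
qed

lemma sa_square_sum: "(\<And>i. i \<in> I \<Longrightarrow> sa_square (f i)) \<Longrightarrow> sa_square (sum f I)"
  by (induction I rule: infinite_finite_induct) (auto intro: sa_square_add)

lemma sa_square_lim:
  fixes X :: "nat \<Rightarrow> 'a::cstar_algebra"
  assumes X: "X \<longlonglongrightarrow> L" "\<And>n. sa_square (X n)"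
  shows "sa_square L"
proof -
  have "Bseq X" using X(1) by (simp add: convergent_imp_Bseq convergentI)
  \<comment> \<open>One common \<open>N\<close> bounds all terms, so the norm criterion holds for
    every term with the same constant and passes to the limit.\<close>
  then obtain N where N: "\<And>n. norm (X n) \<le> N" by (auto simp: Bseq_def)
  have "(\<lambda>n. norm (scaleR N 1 - X n)) \<longlonglongrightarrow> norm (scaleR N 1 - L)"
    by (intro tendsto_intros X(1))
  then have "norm (scaleR N 1 - L) \<le> N"
    by (rule LIMSEQ_le_const2) (use N X(2) sa_square_norm_le in blast)
  moreover have "selfadjoint L"
    using selfadjoint_lim[OF X(1)] X(2) sa_square_selfadjoint by blast
  ultimately show ?thesis by (auto simp: sa_square_iff_norm)
qed

text \<open>The roots inherit commutation one after the other: y commutes with x, hence with a; then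
  a commutes with y, hence with b. So the product is (a b)^2 with a b self-adjoint.\<close>

lemma sa_square_mult:
  fixes x y :: "'a::cstar_algebra"
  assumes "sa_square x" "sa_square y" "x * y = y * x"
  shows "sa_square (x * y)"
proof -
  obtain a where a: "selfadjoint a" "x = a * a" "\<And>c. c * x = x * c \<Longrightarrow> c * a = a * c"
    using sa_square_root[OF assms(1)] by metis
  obtain b where b: "selfadjoint b" "y = b * b" "\<And>c. c * y = y * c \<Longrightarrow> c * b = b * c"
    using sa_square_root[OF assms(2)] by metis
  have "y * a = a * y" using a(3) assms(3) by simp
  then have ab: "a * b = b * a" using b(3) by simp
  have "x * y = (a * b) * (a * b)" unfolding a(2) b(2) by (metis ab mult.assoc)
  then show ?thesis using selfadjoint_mult[OF a(1) b(1) ab] by (auto simp: sa_square_def)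
qed

lemma sa_square_conj:
  assumes "sa_square x"
  obtains z where "adj y * x * y = adj z * (z::'a::cstar_algebra)"
proof -
  obtain a where "selfadjoint a" "x = a * a" using assms by (auto simp: sa_square_def)
  then have "adj y * x * y = adj (a * y) * (a * y)"
    by (simp add: adj_mult selfadjoint_def mult.assoc)
  then show ?thesis using that by blast
qed

section \<open>Invertible elements and the norm\<close>

lemma cinvertible_near_one:
  fixes u :: "'a::cstar_algebra"
  assumes "norm (1 - u) < 1"
  shows "cinvertible u"
proof -
  define v where "v = 1 - u"
  have sm: "summable (\<lambda>n. v ^ n)"
    using assms by (simp add: v_def complete_algebra_summable_geometric)
  define s where "s = (\<Sum>n. v ^ n)"
  have sh: "(\<Sum>n. v ^ Suc n) = s - 1" using suminf_split_head[OF sm] by (simp add: s_def)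
  have "v * s = s - 1" using suminf_mult[OF sm, of v] sh by (simp add: s_def)
  moreover have "s * v = s - 1"
    using suminf_mult2[OF sm, of v] sh by (simp add: s_def power_commutes)
  ultimately have "u * s = 1" "s * u = 1" by (simp_all add: v_def algebra_simps)
  then show ?thesis by (auto simp: cinvertible_def)
qed

lemma cinvertible_scaleR:
  fixes x :: "'a::cstar_algebra"
  assumes "r \<noteq> 0" shows "cinvertible (scaleR r x) \<longleftrightarrow> cinvertible x"
proof -
  have "cinvertible (scaleR r x)" if r: "r \<noteq> 0" and x: "cinvertible x" for r and x :: 'a
  proof -
    obtain y where "x * y = 1" "y * x = 1" using x by (auto simp: cinvertible_def)
    then have "scaleR r x * scaleR (1/r) y = 1" "scaleR (1/r) y * scaleR r x = 1"
      using r by auto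
    then show ?thesis unfolding cinvertible_def by blast
  qed
  from this[of r x] this[of "1/r" "scaleR r x"] assms show ?thesis by auto
qed

lemma cinvertible_mult:
  fixes x y :: "'a::cstar_algebra"
  assumes "cinvertible x" "cinvertible y" shows "cinvertible (x * y)"
proof -
  obtain x' y' where *: "x * x' = 1" "x' * x = 1" "y * y' = 1" "y' * y = 1"
    using assms by (auto simp: cinvertible_def)
  have "x * y * (y' * x') = 1" "y' * x' * (x * y) = 1"
    by (metis * mult.assoc mult_1_right)+
  then show ?thesis by (auto simp: cinvertible_def)
qed

text \<open>After division by N = norm (u^2) + \<beta>, the distance to 1 is norm (norm (u^2) - u^2)
  / N. By \<open>norm_square_complement\<close> it is at most norm (u^2) / N < 1.\<close>

lemma cinvertible_square_plus:
  fixes u :: "'a::cstar_algebra"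
  assumes u: "selfadjoint u" and \<beta>: "\<beta> > 0"
  shows "cinvertible (u * u + scaleR \<beta> 1)"
proof -
  define N where "N = norm (u * u) + \<beta>"
  have N: "N > 0" using \<beta> norm_ge_zero[of "u * u"] by (simp add: N_def add_nonneg_pos)
  have "1 - scaleR (1/N) (u * u + scaleR \<beta> 1) = scaleR (1/N) (scaleR (norm (u * u)) 1 - u * u)"
  proof -
    have "(1::'a) = scaleR (1/N) (scaleR N 1)" using N by simp
    also have "\<dots> - scaleR (1/N) (u * u + scaleR \<beta> 1)
        = scaleR (1/N) (scaleR (norm (u * u)) 1 - u * u)"
      by (simp add: N_def scaleR_diff_right[symmetric] scaleR_left_distrib)
    finally show ?thesis .
  qed
  then have "norm (1 - scaleR (1/N) (u * u + scaleR \<beta> 1))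
      = norm (scaleR (norm (u * u)) 1 - u * u) / N" using N by simp
  also have "\<dots> \<le> norm (u * u) / N"
    using norm_square_complement[OF u order_refl] N by (simp add: divide_right_mono)
  also have "\<dots> < 1" using N \<beta> by (simp add: N_def)
  finally have "cinvertible (scaleR (1/N) (u * u + scaleR \<beta> 1))" by (rule cinvertible_near_one)
  then show ?thesis using N cinvertible_scaleR[of "1/N" "u * u + scaleR \<beta> 1"] by simp
qed

text \<open>This replaces the spectral radius formula: a self-adjoint element of norm 1 has \<open>1\<close> or
  \<open>-1\<close> in its spectrum. If \<open>M\<close> bounds the inverse of \<open>1 - x\<^sup>2\<close>, then \<open>M (1 - x\<^sup>2) - 1\<close> is a
  square commuting with \<open>x\<close>, so \<open>M x\<^sup>2 \<le> M - 1\<close>.\<close>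

lemma norm_less_one_if_cinvertible:
  fixes x :: "'a::cstar_algebra"
  assumes x: "selfadjoint x" "norm x \<le> 1" and inv: "cinvertible (1 - x * x)"
  shows "norm x < 1"
proof -
  have nxx: "norm (x * x) \<le> 1" using x by (simp add: norm_selfadjoint_square power_le_one)
  obtain s where s: "selfadjoint s" "s * s = 1 - x * x"
    "\<And>c. c * (x * x) = (x * x) * c \<Longrightarrow> c * s = s * c"
    using square_root_exists[of "x * x"] x nxx by (metis selfadjoint_arith(7))
  obtain w where w: "(s * s) * w = 1" "w * (s * s) = 1"
    using inv s(2) by (auto simp: cinvertible_def)
  have comm_w: "c * w = w * c" if "c * (s * s) = (s * s) * c" for c
  proof -
    have "c * w = w * (s * s) * c * w" by (simp add: w)
    also have "\<dots> = w * (c * ((s * s) * w))" by (metis that mult.assoc)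
    finally show ?thesis by (simp add: w)
  qed
  have sw: "s * w = w * s" by (rule comm_w) (simp add: mult.assoc)
  have "adj w * (s * s) = 1" using arg_cong[OF w(1), of adj] s(1)
    by (simp add: adj_mult selfadjoint_def)
  then have "adj w = w" by (metis w(1) mult.assoc mult_1_left mult_1_right)
  \<comment> \<open>As w inverts s^2 and commutes with s, the element s w is a self-adjoint square
    root of w. Hence \<open>square_complement\<close> applies to it and yields a root r of M -
    w.\<close>
  then have sv: "selfadjoint (s * w)" using s(1) sw by (intro selfadjoint_mult) (auto simp: selfadjoint_def)
  have vv: "(s * w) * (s * w) = w" by (metis sw w(1) mult.assoc mult_1_left mult_1_right)
  define M where "M = norm w"
  have "1 = norm (w * (s * s))" using w by simp
  also have "\<dots> \<le> M * norm (s * s)" by (simp add: M_def norm_mult_ineq)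
  also have "\<dots> \<le> M * 1"
    using norm_square_complement[OF x(1) nxx] s(2)
    by (intro mult_left_mono) (simp_all add: M_def)
  finally have M: "M \<ge> 1" by simp
  have "norm ((s * w) * (s * w)) \<le> M" by (simp add: vv M_def)
  from square_complement[OF sv this, unfolded vv]
  obtain r where r: "selfadjoint r" "scaleR M 1 - w = r * r" "\<And>c. c * w = w * c \<Longrightarrow> c * r = r * c"
    by metis
  have sr: "s * r = r * s" by (rule r(3)) (rule sw)
  have xs: "x * s = s * x" by (rule s(3)) (simp add: mult.assoc)
  have "x * (s * s) = (s * s) * x" by (metis xs mult.assoc)
  then have xr: "x * r = r * x" using comm_w r(3) by blast
  have "(s * r) * (s * r) = (s * s) * (r * r)" by (metis sr mult.assoc)
  also have "\<dots> = scaleR M (s * s) - (s * s) * w"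
    unfolding r(2)[symmetric] by (simp add: right_diff_distrib)
  also have "\<dots> = scaleR M (1 - x * x) - 1" by (subst w(1)) (simp only: s(2))
  finally have sum: "scaleR M (x * x) + (s * r) * (s * r) = scaleR (M - 1) 1"
    by (simp add: algebra_simps)
  define t where "t = scaleR (sqrt M) x"
  have tt: "t * t = scaleR M (x * x)" using M by (simp add: t_def)
  have "norm (t * t) \<le> norm (t * t + (s * r) * (s * r))"
  proof (rule norm_square_le_sum_squares)
    show "selfadjoint t" using x by (simp add: t_def)
    show "selfadjoint (s * r)" by (intro selfadjoint_mult s r sr)
    show "t * (s * r) = s * r * t" unfolding t_def using xs xr
      by simp (metis mult.assoc)
  qed
  then have "M * norm (x * x) \<le> M - 1" using sum tt M by simp
  then have "M * (norm x)\<^sup>2 < M * 1" using x by (simp add: norm_selfadjoint_square)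
  then have "(norm x)\<^sup>2 < 1\<^sup>2" using M by (subst (asm) mult_less_cancel_left_pos) auto
  then show ?thesis by (rule power_less_imp_less_base) simp
qed

section \<open>Continuous functional calculus\<close>

lemma peval_0 [simp]: "peval 0 x = 0"
  by (simp add: peval_def)

lemma peval_pCons [simp]: "peval (pCons a p) x = scaleR a 1 + x * peval p (x::'a::cstar_algebra)"
proof (cases "p = 0")
  case False
  have "peval (pCons a p) x = (\<Sum>i\<le>Suc (degree p). scaleR (coeff (pCons a p) i) (x ^ i))"
    using False by (simp add: peval_def)
  also have "\<dots> = scaleR a 1 + (\<Sum>i\<le>degree p. scaleR (coeff p i) (x * x ^ i))"
    by (simp del: sum.atMost_Suc add: sum.atMost_Suc_shift)
  finally show ?thesis by (simp add: peval_def sum_distrib_left)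
qed (simp add: peval_def)

lemma peval_1 [simp]: "peval 1 x = 1"
  by (simp add: one_pCons)

lemma peval_add: "peval (p + q) x = peval p x + peval q x"
  by (induction p q rule: poly_induct2) (simp_all add: algebra_simps)

lemma peval_smult: "peval (smult c p) x = scaleR c (peval p x)"
  by (induction p) (simp_all add: scaleR_add_right)

lemma peval_diff: "peval (p - q) x = peval p x - peval q x"
  using peval_add[of "p - q" q x] by simp

lemma peval_sum: "peval (\<Sum>i\<in>I. p i) x = (\<Sum>i\<in>I. peval (p i) x)"
  by (induction I rule: infinite_finite_induct) (simp_all add: peval_add)

lemma peval_commute: "c * x = x * c \<Longrightarrow> c * peval p x = peval p x * c"
proof (induction p)
  case (pCons a p)
  then have "c * (x * peval p x) = (x * peval p x) * c" by (metis mult.assoc)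
  then show ?case by (simp add: algebra_simps)
qed simp

lemma peval_mult: "peval (p * q) x = peval p x * peval q x"
  by (induction p) (simp_all add: peval_add peval_smult algebra_simps)

lemma peval_power: "peval (p ^ n) x = peval p x ^ n"
  by (induction n) (simp_all add: peval_mult)

lemma selfadjoint_peval: "selfadjoint x \<Longrightarrow> selfadjoint (peval p x)"
proof (induction p)
  case (pCons a p)
  then have "selfadjoint (x * peval p x)"
    by (intro selfadjoint_mult peval_commute) auto
  then show ?case by simp
qed simp

section \<open>Real spectrum, spectral mapping and the norm bound\<close>

definition rspec :: "'a::cstar_algebra \<Rightarrow> real set" where
  "rspec x = {t. complex_of_real t \<in> cspectrum x}"

lemma rspec_iff: "t \<in> rspec x \<longleftrightarrow> \<not> cinvertible (x - scaleR t 1)"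
  by (simp add: rspec_def cspectrum_def cscale_of_real)

lemma poly_complex_of_real_hom:
  fixes p q :: "real poly" and z :: complex
  shows "poly (map_poly complex_of_real (p + q)) z
           = poly (map_poly of_real p) z + poly (map_poly of_real q) z"
    and "poly (map_poly complex_of_real (p * q)) z
           = poly (map_poly of_real p) z * poly (map_poly of_real q) z"
    and "poly (map_poly complex_of_real p) (of_real t) = of_real (poly p t)"
proof -
  have sm: "poly (map_poly complex_of_real (smult c p)) z = of_real c * poly (map_poly of_real p) z"
    for c p by (induction p) (simp_all add: map_poly_pCons algebra_simps)
  have ad: "poly (map_poly complex_of_real (p + q)) z
      = poly (map_poly of_real p) z + poly (map_poly of_real q) z" for p q
    by (induction p q rule: poly_induct2) (simp_all add: map_poly_pCons algebra_simps)
  show "poly (map_poly complex_of_real (p + q)) z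
      = poly (map_poly of_real p) z + poly (map_poly of_real q) z" by (rule ad)
  show "poly (map_poly complex_of_real (p * q)) z
      = poly (map_poly of_real p) z * poly (map_poly of_real q) z"
    by (induction p) (simp_all add: map_poly_pCons ad sm algebra_simps)
  show "poly (map_poly complex_of_real p) (of_real t) = of_real (poly p t)"
    by (induction p) (simp_all add: map_poly_pCons)
qed

text \<open>At a non-real root z, divide p by q = (t - Re z)^2 + (Im z)^2. The remainder c + d t
  vanishes at z; its imaginary part forces d = 0 and then c = 0. At an algebra element the quadratic
  becomes u^2 + b^2 with u = x - a, the form treated in
  \<open>cinvertible_square_plus\<close>.\<close>

lemma poly_complex_root_cases:
  fixes p :: "real poly"
  assumes "degree p > 0"
  obtains (real) t k where "p = [:- t, 1:] * k"
    | (complex) a b k where "b \<noteq> 0" "p = [:a\<^sup>2 + b\<^sup>2, - 2 * a, 1:] * k"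
proof -
  have "\<not> constant (poly (map_poly complex_of_real p))"
    using assms by (simp add: constant_degree degree_map_poly)
  then obtain z where z: "poly (map_poly complex_of_real p) z = 0"
    using fundamental_theorem_of_algebra by blast
  show ?thesis
  proof (cases "Im z = 0")
    case True
    then have "z = of_real (Re z)" by (simp add: complex_eq_iff)
    then have "poly p (Re z) = 0" using z poly_complex_of_real_hom(3)[of p "Re z"] by simp
    then obtain k where "p = [:- Re z, 1:] * k" using poly_eq_0_iff_dvd by blast
    then show ?thesis by (rule real)
  next
    case False
    define q where "q = [:(Re z)\<^sup>2 + (Im z)\<^sup>2, - 2 * Re z, 1:]"
    have "poly (map_poly complex_of_real q) z = 0"
      by (simp add: q_def map_poly_pCons complex_eq_iff power2_eq_square algebra_simps)
    moreover have pq: "p = q * (p div q) + p mod q" by simp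
    ultimately have m0: "poly (map_poly complex_of_real (p mod q)) z = 0"
      using z by (metis poly_complex_of_real_hom(1,2) add_0 mult_zero_left)
    have "degree (p mod q) < degree q \<or> p mod q = 0"
      using degree_mod_less[of q p] by (auto simp: q_def)
    then have dm: "degree (p mod q) \<le> 1" by (auto simp: q_def)
    obtain c m where cm: "p mod q = pCons c m" by (rule pCons_cases)
    then have "degree m = 0" using dm by (auto split: if_splits)
    then obtain d where cd: "p mod q = [:c, d:]" unfolding cm by (auto elim: degree_eq_zeroE)
    have "d * Im z = 0" "c + d * Re z = 0"
      using m0 by (simp_all add: cd map_poly_pCons complex_eq_iff mult.commute)
    then have "p mod q = 0" using False cd by simp
    then have "p = q * (p div q)" using pq by simp
    then show ?thesis using complex[OF False] by (simp add: q_def)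
  qed
qed

text \<open>The spectral mapping theorem without complex numbers: the irreducible quadratic factors of
  a real polynomial are invertible at a self-adjoint element.\<close>

lemma peval_not_cinvertible:
  fixes x :: "'a::cstar_algebra"
  assumes x: "selfadjoint x" and "p \<noteq> 0" "\<not> cinvertible (peval p x)"
  shows "\<exists>t\<in>rspec x. poly p t = 0"
  using assms(2,3)
proof (induction "degree p" arbitrary: p rule: less_induct)
  case less
  show ?case
  proof (cases "degree p = 0")
    case True
    then obtain c where c: "p = [:c:]" by (rule degree_eq_zeroE)
    then have "c \<noteq> 0" using less.prems by simp
    then have "cinvertible (scaleR c (1::'a))"
      by (simp add: cinvertible_scaleR) (auto simp: cinvertible_def)
    then show ?thesis using less.prems c by simp
  next
    case False
    then have "degree p > 0" by simp
    then show ?thesis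
    proof (cases rule: poly_complex_root_cases)
      case (real t k)
      have k: "k \<noteq> 0" using real less.prems by auto
      have ev: "peval p x = (x - scaleR t 1) * peval k x"
        unfolding real peval_mult by simp
      have "degree k < degree p" unfolding real using k by (subst degree_mult_eq) auto
      note IH = less.hyps[OF this k]
      show ?thesis
      proof (cases "t \<in> rspec x")
        case True
        then show ?thesis unfolding real by (intro bexI[of _ t]) simp_all
      next
        case False
        then have "\<not> cinvertible (peval k x)"
          using less.prems(2) cinvertible_mult unfolding ev rspec_iff by blast
        then show ?thesis using IH unfolding real by auto
      qed
    next
      case (complex a b k)
      have k: "k \<noteq> 0" using complex less.prems by auto
      define u where "u = x - scaleR a 1"
      have "peval [:a\<^sup>2 + b\<^sup>2, - 2 * a, 1:] x = u * u + scaleR (b\<^sup>2) 1"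
        by (simp add: u_def algebra_simps power2_eq_square scaleR_2[symmetric])
      then have ev: "peval p x = (u * u + scaleR (b\<^sup>2) 1) * peval k x"
        unfolding complex(2) peval_mult by simp
      have "cinvertible (u * u + scaleR (b\<^sup>2) 1)"
        by (rule cinvertible_square_plus) (use x complex(1) in \<open>simp_all add: u_def\<close>)
      then have nk: "\<not> cinvertible (peval k x)"
        using less.prems(2) cinvertible_mult unfolding ev by blast
      have "degree k < degree p" unfolding complex(2) using k by (subst degree_mult_eq) auto
      from less.hyps[OF this k nk] obtain t where "t \<in> rspec x" "poly k t = 0" by blast
      then show ?thesis unfolding complex(2) by (intro bexI[of _ t]) (simp_all only: poly_mult mult_zero_right)
    qed
  qed
qed

text \<open>Contrapositive of \<open>norm_less_one_if_cinvertible\<close> for x / norm x. It says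
  that the spectrum of x^2 contains its norm.\<close>

lemma not_cinvertible_norm_square:
  fixes x :: "'a::cstar_algebra"
  assumes x: "selfadjoint x"
  shows "\<not> cinvertible (scaleR ((norm x)\<^sup>2) 1 - x * x)"
proof (cases "x = 0")
  case True
  then show ?thesis by (simp add: cinvertible_def)
next
  case False
  define y where "y = scaleR (1 / norm x) x"
  have "norm y = 1" "selfadjoint y" using False x by (simp_all add: y_def)
  then have "\<not> cinvertible (1 - y * y)" using norm_less_one_if_cinvertible[of y] by auto
  moreover have "scaleR ((norm x)\<^sup>2) 1 - x * x = scaleR ((norm x)\<^sup>2) (1 - y * y)"
    using False by (simp add: y_def scaleR_diff_right power2_eq_square)
  ultimately show ?thesis using False cinvertible_scaleR[of "(norm x)\<^sup>2" "1 - y * y"] by simp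
qed

text \<open>The polynomial (norm x)^2 - t^2 has a non-invertible value at x, so one of its roots is
  in the spectrum.\<close>

lemma rspec_nonempty:
  fixes x :: "'a::cstar_algebra"
  assumes x: "selfadjoint x" shows "rspec x \<noteq> {}"
proof -
  define p where "p = [:(norm x)\<^sup>2, 0, -1:]"
  have "peval p x = scaleR ((norm x)\<^sup>2) 1 - x * x" by (simp add: p_def)
  then show ?thesis
    using peval_not_cinvertible[OF x, of p] not_cinvertible_norm_square[OF x]
    by (auto simp: p_def)
qed

text \<open>With n the norm of p(x), the polynomial n^2 - p^2 is not invertible at x. By spectral
  mapping it vanishes at some spectral point t, where n = |p(t)|. Applied to differences of
  polynomials, this bound makes the functional calculus well defined.\<close>

lemma norm_peval_le:
  fixes x :: "'a::cstar_algebra"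
  assumes x: "selfadjoint x" and M: "\<And>t. t \<in> rspec x \<Longrightarrow> \<bar>poly p t\<bar> \<le> M"
  shows "norm (peval p x) \<le> M"
proof -
  define n where "n = norm (peval p x)"
  define q where "q = [:n\<^sup>2:] - p * p"
  have pq: "poly q t = n\<^sup>2 - (poly p t)\<^sup>2" for t by (simp add: q_def power2_eq_square)
  have "peval q x = scaleR (n\<^sup>2) 1 - peval p x * peval p x"
    by (simp add: q_def peval_diff peval_mult)
  then have ni: "\<not> cinvertible (peval q x)"
    using not_cinvertible_norm_square[OF selfadjoint_peval[OF x]] by (simp add: n_def)
  have "\<exists>t\<in>rspec x. poly q t = 0"
  proof (cases "q = 0")
    \<comment> \<open>Spectral mapping excludes the zero polynomial. Here every spectral point is a
      root, so existence of one suffices.\<close>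
    case True
    then show ?thesis using rspec_nonempty[OF x] by auto
  next
    case False
    then show ?thesis using peval_not_cinvertible[OF x False ni] by blast
  qed
  then obtain t where t: "t \<in> rspec x" "(poly p t)\<^sup>2 = n\<^sup>2" unfolding pq by auto
  then have "\<bar>poly p t\<bar> = n" by (metis abs_norm_cancel n_def power2_eq_iff abs_minus_cancel)
  then show ?thesis using M[OF t(1)] by (simp add: n_def)
qed

lemma rspec_bound:
  fixes x :: "'a::cstar_algebra"
  assumes "t \<in> rspec x" shows "\<bar>t\<bar> \<le> norm x"
proof (rule ccontr)
  assume "\<not> \<bar>t\<bar> \<le> norm x"
  then have t: "t \<noteq> 0" "norm x < \<bar>t\<bar>" using norm_ge_zero[of x] by linarith+
  have "1 - scaleR (- 1 / t) (x - scaleR t 1) = scaleR (1 / t) x"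
    using t by (simp add: scaleR_diff_right)
  then have "norm (1 - scaleR (- 1 / t) (x - scaleR t 1)) < 1" using t by simp
  then have "cinvertible (scaleR (- 1 / t) (x - scaleR t 1))" by (rule cinvertible_near_one)
  then show False using assms t cinvertible_scaleR[of "- 1 / t" "x - scaleR t 1"]
    by (simp add: rspec_iff)
qed

text \<open>If z inverts x - t, then x - s = (x - t) (1 - (s - t) z), and the second factor is
  invertible for s close to t.\<close>

lemma closed_rspec: "closed (rspec (x::'a::cstar_algebra))"
  unfolding closed_sequential_limits
proof safe
  fix s t assume s: "\<forall>n. s n \<in> rspec x" and st: "s \<longlonglongrightarrow> t"
  show "t \<in> rspec x"
  proof (rule ccontr)
    assume "t \<notin> rspec x"
    then obtain z where z: "(x - scaleR t 1) * z = 1" "z * (x - scaleR t 1) = 1"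
      by (auto simp: rspec_iff cinvertible_def)
    have "(\<lambda>n. norm (scaleR (s n - t) z)) \<longlonglongrightarrow> norm (scaleR (t - t) z)"
      by (intro tendsto_intros st)
    then have "eventually (\<lambda>n. norm (scaleR (s n - t) z) < 1) sequentially"
      by (rule order_tendstoD(2)) simp
    then obtain n where n: "norm (scaleR (s n - t) z) < 1"
      by (auto simp: eventually_sequentially)
    have eq: "x - scaleR (s n) 1 = (x - scaleR t 1) * (1 - scaleR (s n - t) z)"
      using z(1) by (simp add: right_diff_distrib) (simp add: algebra_simps)
    have "cinvertible (x - scaleR t 1)" using z by (auto simp: cinvertible_def)
    moreover have "cinvertible (1 - scaleR (s n - t) z)"
      by (rule cinvertible_near_one) (use n in simp)
    ultimately have "cinvertible (x - scaleR (s n) 1)" unfolding eq by (rule cinvertible_mult)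
    then show False using s by (simp add: rspec_iff)
  qed
qed

lemma compact_rspec: "compact (rspec (x::'a::cstar_algebra))"
proof (rule compact_eq_bounded_closed[THEN iffD2])
  show "bounded (rspec x) \<and> closed (rspec x)"
    using closed_rspec rspec_bound[of _ x] by (auto simp: bounded_iff)
qed

lemma peval_convergent:
  fixes x :: "'a::cstar_algebra"
  assumes x: "selfadjoint x"
    and P: "uniform_limit (rspec x) (\<lambda>n t. poly (P n) t) f sequentially"
  shows "convergent (\<lambda>n. peval (P n) x)"
proof (rule Cauchy_convergent, rule CauchyI)
  fix e :: real assume e: "0 < e"
  have "eventually (\<lambda>n. \<forall>t\<in>rspec x. dist (poly (P n) t) (f t) < e / 3) sequentially"
    by (rule uniform_limitD[OF P]) (use e in simp)
  then obtain N where N: "\<And>n t. n \<ge> N \<Longrightarrow> t \<in> rspec x \<Longrightarrow> \<bar>poly (P n) t - f t\<bar> < e / 3"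
    by (auto simp: eventually_sequentially dist_real_def)
  have "norm (peval (P m) x - peval (P n) x) < e" if "m \<ge> N" "n \<ge> N" for m n
  proof -
    have "norm (peval (P m - P n) x) \<le> 2 * e / 3"
    proof (rule norm_peval_le[OF x])
      fix t assume t: "t \<in> rspec x"
      show "\<bar>poly (P m - P n) t\<bar> \<le> 2 * e / 3"
        using N[OF that(1) t] N[OF that(2) t] by (simp add: abs_if split: if_splits)
    qed
    then show ?thesis using e by (simp add: peval_diff)
  qed
  then show "\<exists>M. \<forall>m\<ge>M. \<forall>n\<ge>M. norm (peval (P m) x - peval (P n) x) < e" by blast
qed

lemma peval_diff_tendsto_0:
  fixes x :: "'a::cstar_algebra"
  assumes x: "selfadjoint x"
    and P: "uniform_limit (rspec x) (\<lambda>n t. poly (P n) t) f sequentially"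
    and Q: "uniform_limit (rspec x) (\<lambda>n t. poly (Q n) t) f sequentially"
  shows "(\<lambda>n. peval (Q n) x - peval (P n) x) \<longlonglongrightarrow> 0"
proof (rule tendstoI)
  fix e :: real assume e: "0 < e"
  have "uniform_limit (rspec x) (\<lambda>n t. poly (Q n) t - poly (P n) t) (\<lambda>t. f t - f t) sequentially"
    by (intro uniform_limit_minus P Q)
  then have "eventually (\<lambda>n. \<forall>t\<in>rspec x. dist (poly (Q n) t - poly (P n) t) (f t - f t) < e / 2)
      sequentially" by (rule uniform_limitD) (use e in simp)
  then show "eventually (\<lambda>n. dist (peval (Q n) x - peval (P n) x) 0 < e) sequentially"
  proof eventually_elim
    case (elim n)
    then have "norm (peval (Q n - P n) x) \<le> e / 2" by (intro norm_peval_le[OF x]) force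
    then show ?case using e by (simp add: peval_diff)
  qed
qed

text \<open>The given sequence \<open>P\<close> is what determines the description in
  \<open>cfc\<close>: without any approximating sequence every y would satisfy it.
  \<open>peval_diff_tendsto_0\<close> shows that all other sequences share the limit of
  \<open>P\<close>.\<close>

lemma cfc_tendsto:
  fixes x :: "'a::cstar_algebra"
  assumes x: "selfadjoint x"
    and P: "uniform_limit (rspec x) (\<lambda>n t. poly (P n) t) f sequentially"
  shows "(\<lambda>n. peval (P n) x) \<longlonglongrightarrow> cfc f x"
proof -
  obtain y where y: "(\<lambda>n. peval (P n) x) \<longlonglongrightarrow> y"
    using peval_convergent[OF x P] by (auto simp: convergent_def)
  have "(\<lambda>n. peval (Q n) x) \<longlonglongrightarrow> y"
    if "uniform_limit (rspec x) (\<lambda>n t. poly (Q n) t) f sequentially" for Q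
    using tendsto_add[OF peval_diff_tendsto_0[OF x P that] y] by simp
  then have "cfc f x = y"
    unfolding cfc_def rspec_def[symmetric]
    by (intro the_equality) (use P y LIMSEQ_unique in blast)+
  then show ?thesis using y by simp
qed

section \<open>Bernstein approximation on [-R, R]\<close>

definition bernstein_node :: "real \<Rightarrow> nat \<Rightarrow> nat \<Rightarrow> real" where
  "bernstein_node R n k = R * (2 * (k / n) - 1)"

text \<open>The Bernstein basis polynomial transported from [0, 1] by s = 1/2 + t/(2R). The factors
  s and 1 - s are kept separate because each is positive at x when norm x is at most R.\<close>

definition bernstein_poly :: "real \<Rightarrow> nat \<Rightarrow> nat \<Rightarrow> real poly" where
  "bernstein_poly R n k = smult (of_nat (n choose k))
     ([:1/2, 1/(2*R):] ^ k * [:1/2, - 1/(2*R):] ^ (n - k))"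

lemma poly_bernstein_poly: "poly (bernstein_poly R n k) t = Bernstein n k (1/2 + t/(2*R))"
  by (simp add: bernstein_poly_def Bernstein_def)

lemma sum_bernstein_poly: "(\<Sum>k\<le>n. bernstein_poly R n k) = 1"
proof -
  have "poly (\<Sum>k\<le>n. bernstein_poly R n k) = poly 1"
    by (rule ext) (simp add: poly_sum poly_bernstein_poly)
  then show ?thesis by (simp only: poly_eq_poly_eq_iff)
qed

lemma bernstein_uniform_limit:
  assumes R: "R > 0" and S: "\<And>t. t \<in> S \<Longrightarrow> \<bar>t\<bar> \<le> R" and f: "continuous_on UNIV f"
  shows "uniform_limit S (\<lambda>n t. poly (\<Sum>k\<le>n. smult (f (bernstein_node R n k)) (bernstein_poly R n k)) t)
    f sequentially"
proof (rule uniform_limitI)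
  fix e :: real assume e: "0 < e"
  define h where "h s = f (R * (2 * s - 1))" for s
  have "continuous_on {0..1} h" unfolding h_def
    by (intro continuous_on_compose2[OF f] continuous_intros) auto
  from Bernstein_Weierstrass[OF this e] obtain N where
    N: "\<And>n s. N \<le> n \<Longrightarrow> s \<in> {0..1} \<Longrightarrow> \<bar>h s - (\<Sum>k\<le>n. h (k/n) * Bernstein n k s)\<bar> < e"
    by blast
  have "dist (poly (\<Sum>k\<le>n. smult (f (bernstein_node R n k)) (bernstein_poly R n k)) t) (f t) < e"
    if n: "n \<ge> N" and t: "t \<in> S" for n t
  proof -
    define s where "s = 1/2 + t/(2*R)"
    have "s \<in> {0..1}" using S[OF t] R by (auto simp: s_def field_simps abs_le_iff)
    from N[OF n this] have "\<bar>h s - (\<Sum>k\<le>n. h (k/n) * Bernstein n k s)\<bar> < e" .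
    moreover have "h s = f t" using R by (simp add: h_def s_def field_simps)
    moreover have "poly (\<Sum>k\<le>n. smult (f (bernstein_node R n k)) (bernstein_poly R n k)) t
        = (\<Sum>k\<le>n. h (k/n) * Bernstein n k s)"
      by (simp add: poly_sum poly_bernstein_poly bernstein_node_def h_def s_def)
    ultimately show ?thesis by (simp add: dist_real_def abs_minus_commute)
  qed
  then show "eventually (\<lambda>n. \<forall>t\<in>S. dist (poly (\<Sum>k\<le>n. smult (f (bernstein_node R n k))
      (bernstein_poly R n k)) t) (f t) < e) sequentially"
    unfolding eventually_sequentially by blast
qed

lemma sa_square_power: "sa_square x \<Longrightarrow> sa_square (x ^ n)"
  by (induction n) (auto intro!: sa_square_mult simp: power_commutes)

text \<open>Each linear factor at x differs from 1/2 by at most norm x / (2R), hence by at most 1/2,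
  so the norm criterion applies with N = 1/2. Powers and products stay positive because everything
  commutes.\<close>

lemma sa_square_bernstein_poly:
  fixes x :: "'a::cstar_algebra"
  assumes x: "selfadjoint x" "norm x \<le> R" and R: "R > 0"
  shows "sa_square (peval (bernstein_poly R n k) x)"
proof -
  have sq: "sa_square (peval [:1/2, c:] x)" if c: "\<bar>c\<bar> = 1/(2*R)" for c
  proof -
    have "\<bar>c\<bar> * norm x \<le> \<bar>c\<bar> * R" using x(2) by (intro mult_left_mono) simp_all
    also have "\<dots> = 1/2" using R c by simp
    finally have "norm (scaleR (1/2) 1 - peval [:1/2, c:] x) \<le> 1/2" by simp
    moreover have "selfadjoint (peval [:1/2, c:] x)" by (rule selfadjoint_peval[OF x(1)])
    ultimately show ?thesis unfolding sa_square_iff_norm by blast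
  qed
  have "sa_square (peval ([:1/2, 1/(2*R):] ^ k) x * peval ([:1/2, - 1/(2*R):] ^ (n - k)) x)"
  proof (rule sa_square_mult)
    show "sa_square (peval ([:1/2, 1/(2*R):] ^ k) x)"
      "sa_square (peval ([:1/2, - 1/(2*R):] ^ (n - k)) x)"
      unfolding peval_power using R by (intro sa_square_power sq; simp)+
  qed (simp only: peval_mult[symmetric] mult.commute)
  then show ?thesis
    by (simp add: bernstein_poly_def peval_smult peval_mult sa_square_scaleR)
qed

text \<open>The weights u and nodes \<tau> do not depend on f, so f, g and their product can be
  approximated over the same partition of unity.\<close>

lemma bernstein_cfc:
  fixes x :: "'a::cstar_algebra"
  assumes x: "selfadjoint x"
  obtains u \<tau> where "\<And>n k. sa_square (u n k)" "\<And>n. (\<Sum>k\<le>n. u n k) = 1"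
    "\<And>f. continuous_on UNIV f \<Longrightarrow> (\<lambda>n. \<Sum>k\<le>n. scaleR (f (\<tau> n k)) (u n k)) \<longlonglongrightarrow> cfc f x"
proof -
  \<comment> \<open>Adding 1 keeps \<open>R\<close> positive even for x = 0.\<close>
  define R where "R = norm x + 1"
  have R: "R > 0" "norm x \<le> R" by (simp_all add: R_def add_nonneg_pos)
  show ?thesis
  proof (rule that[of "\<lambda>n k. peval (bernstein_poly R n k) x" "bernstein_node R"])
    show "sa_square (peval (bernstein_poly R n k) x)" for n k
      by (rule sa_square_bernstein_poly[OF x R(2,1)])
    show "(\<Sum>k\<le>n. peval (bernstein_poly R n k) x) = 1" for n
      by (simp add: sum_bernstein_poly flip: peval_sum)
    show "(\<lambda>n. \<Sum>k\<le>n. scaleR (f (bernstein_node R n k)) (peval (bernstein_poly R n k) x)) \<longlonglongrightarrow> cfc f x"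
      if f: "continuous_on UNIV f" for f
      using cfc_tendsto[OF x bernstein_uniform_limit[OF R(1) _ f]] rspec_bound R(2)
      by (fastforce simp: peval_sum peval_smult)
  qed
qed

section \<open>Algebraic rules of the functional calculus\<close>

lemma cfc_polys:
  fixes x :: "'a::cstar_algebra"
  assumes x: "selfadjoint x" and f: "continuous_on UNIV f"
  obtains P where "uniform_limit (rspec x) (\<lambda>n t. poly (P n) t) f sequentially"
    "(\<lambda>n. peval (P n) x) \<longlonglongrightarrow> cfc f x"
proof -
  have "t \<in> rspec x \<Longrightarrow> \<bar>t\<bar> \<le> norm x + 1" for t using rspec_bound[of t x] by simp
  then have "uniform_limit (rspec x) (\<lambda>n t. poly (\<Sum>k\<le>n. smult (f (bernstein_node (norm x + 1) n k))
      (bernstein_poly (norm x + 1) n k)) t) f sequentially"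
    by (intro bernstein_uniform_limit f) (simp_all add: add_nonneg_pos)
  from that[OF this cfc_tendsto[OF x this]] show ?thesis .
qed

lemma selfadjoint_cfc:
  assumes "selfadjoint x" "continuous_on UNIV f" shows "selfadjoint (cfc f x)"
  using cfc_polys[OF assms] selfadjoint_lim selfadjoint_peval[OF assms(1)] by metis

lemma cfc_commute:
  fixes x :: "'a::cstar_algebra"
  assumes "selfadjoint x" "continuous_on UNIV f" "c * x = x * c"
  shows "c * cfc f x = cfc f x * c"
proof -
  obtain P where P: "(\<lambda>n. peval (P n) x) \<longlonglongrightarrow> cfc f x" using cfc_polys[OF assms(1,2)] by metis
  have "(\<lambda>n. c * peval (P n) x) \<longlonglongrightarrow> c * cfc f x" "(\<lambda>n. peval (P n) x * c) \<longlonglongrightarrow> cfc f x * c"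
    by (intro tendsto_intros P)+
  then show ?thesis unfolding peval_commute[OF assms(3)] by (rule LIMSEQ_unique)
qed

lemma cfc_mult:
  fixes x :: "'a::cstar_algebra"
  assumes x: "selfadjoint x" and f: "continuous_on UNIV f" and g: "continuous_on UNIV g"
  shows "cfc (\<lambda>t. f t * g t) x = cfc f x * cfc g x"
proof -
  obtain P where P: "uniform_limit (rspec x) (\<lambda>n t. poly (P n) t) f sequentially"
    "(\<lambda>n. peval (P n) x) \<longlonglongrightarrow> cfc f x" using cfc_polys[OF x f] by metis
  obtain Q where Q: "uniform_limit (rspec x) (\<lambda>n t. poly (Q n) t) g sequentially"
    "(\<lambda>n. peval (Q n) x) \<longlonglongrightarrow> cfc g x" using cfc_polys[OF x g] by metis
  have bdd: "bounded (h ` rspec x)" if "continuous_on UNIV h" for h :: "real \<Rightarrow> real"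
    by (intro compact_imp_bounded compact_continuous_image compact_rspec continuous_on_subset[OF that]) simp
  have "uniform_limit (rspec x) (\<lambda>n t. poly (P n * Q n) t) (\<lambda>t. f t * g t) sequentially"
    using uniform_lim_mult[OF P(1) Q(1) bdd[OF f] bdd[OF g]] by simp
  from cfc_tendsto[OF x this] tendsto_mult[OF P(2) Q(2)] show ?thesis
    using LIMSEQ_unique by (simp add: peval_mult)
qed

lemma cfc_diff:
  fixes x :: "'a::cstar_algebra"
  assumes x: "selfadjoint x" and f: "continuous_on UNIV f" and g: "continuous_on UNIV g"
  shows "cfc (\<lambda>t. f t - g t) x = cfc f x - cfc g x"
proof -
  obtain P where P: "uniform_limit (rspec x) (\<lambda>n t. poly (P n) t) f sequentially"
    "(\<lambda>n. peval (P n) x) \<longlonglongrightarrow> cfc f x" using cfc_polys[OF x f] by metis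
  obtain Q where Q: "uniform_limit (rspec x) (\<lambda>n t. poly (Q n) t) g sequentially"
    "(\<lambda>n. peval (Q n) x) \<longlonglongrightarrow> cfc g x" using cfc_polys[OF x g] by metis
  have "uniform_limit (rspec x) (\<lambda>n t. poly (P n - Q n) t) (\<lambda>t. f t - g t) sequentially"
    using uniform_limit_minus[OF P(1) Q(1)] by simp
  from cfc_tendsto[OF x this] tendsto_diff[OF P(2) Q(2)] show ?thesis
    using LIMSEQ_unique by (simp add: peval_diff)
qed

lemma cfc_poly:
  fixes x :: "'a::cstar_algebra"
  assumes x: "selfadjoint x" shows "cfc (poly p) x = peval p x"
proof -
  have "uniform_limit (rspec x) (\<lambda>n::nat. \<lambda>t. poly p t) (poly p) sequentially"
    by (rule uniform_limit_const)
  from cfc_tendsto[OF x this] show ?thesis by (simp add: LIMSEQ_const_iff)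
qed

lemma cfc_cong:
  assumes "\<And>t. t \<in> rspec x \<Longrightarrow> f t = g t" shows "cfc f x = cfc g x"
proof -
  have "uniform_limit (rspec x) h f sequentially \<longleftrightarrow> uniform_limit (rspec x) h g sequentially" for h
    by (rule uniform_limit_cong') (use assms in auto)
  then show ?thesis unfolding cfc_def rspec_def[symmetric] by simp
qed

section \<open>Positivity of \<open>y\<^sup>* y\<close> and a Cauchy--Schwarz inequality\<close>

text \<open>If w inverts c + a b, then (1 - b w a) / c inverts c + b a. This is the familiar fact
  that a b and b a have the same nonzero spectrum.\<close>

lemma cinvertible_scaleR_plus_swap:
  fixes a b :: "'a::cstar_algebra"
  assumes c: "c \<noteq> 0" and inv: "cinvertible (scaleR c 1 + a * b)"
  shows "cinvertible (scaleR c 1 + b * a)"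
proof -
  obtain w where w: "(scaleR c 1 + a * b) * w = 1" "w * (scaleR c 1 + a * b) = 1"
    using inv by (auto simp: cinvertible_def)
  have "(scaleR c 1 + b * a) * (1 - b * w * a)
      = scaleR c 1 + b * a - b * ((scaleR c 1 + a * b) * w) * a"
    by (simp add: algebra_simps)
  then have l: "(scaleR c 1 + b * a) * scaleR (1/c) (1 - b * w * a) = 1"
    using c unfolding w by simp
  have "(1 - b * w * a) * (scaleR c 1 + b * a)
      = scaleR c 1 + b * a - b * (w * (scaleR c 1 + a * b)) * a"
    by (simp add: algebra_simps)
  then have "scaleR (1/c) (1 - b * w * a) * (scaleR c 1 + b * a) = 1"
    using c unfolding w by simp
  then show ?thesis using l unfolding cinvertible_def by blast
qed

text \<open>For z = a + i b the sum z* z + z z* is 2 (a^2 + b^2), so z z* = 2 (a^2 + b^2) + m^2 is a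
  square. If z were nonzero, (norm m)^2 + z z* would be invertible. Swapping the factors, so would
  (norm m)^2 - m^2, against \<open>not_cinvertible_norm_square\<close>.\<close>

lemma eq_0_if_adj_mult_self_neg_square:
  fixes z m :: "'a::cstar_algebra"
  assumes m: "selfadjoint m" and z: "adj z * z = - (m * m)"
  shows "z = 0"
proof (rule ccontr)
  assume "z \<noteq> 0"
  moreover have "norm (m * m) = (norm z)\<^sup>2" using cstar_identity[of z] z by simp
  ultimately have nm: "norm m \<noteq> 0" using m by (simp add: norm_selfadjoint_square)
  obtain a b where ab: "selfadjoint a" "selfadjoint b" "z = a + cscale \<i> b"
    by (rule cartesian_decomposition)
  have "adj z * z + z * adj z = scaleR 2 (a * a + b * b)"
    using cartesian_squares[OF ab(1,2)] by (simp add: ab(3) scaleR_2)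
  then have "z * adj z = scaleR 2 (a * a + b * b) + m * m" using z by (simp add: algebra_simps)
  moreover have "sa_square (scaleR 2 (a * a + b * b) + m * m)"
    using ab m by (intro sa_square_add sa_square_scaleR) (auto simp: sa_square_def)
  ultimately obtain c where c: "selfadjoint c" "z * adj z = c * c" by (auto simp: sa_square_def)
  have "cinvertible (scaleR ((norm m)\<^sup>2) 1 + z * adj z)"
    using cinvertible_square_plus[OF c(1), of "(norm m)\<^sup>2"] nm c(2) by (simp add: add.commute)
  then have "cinvertible (scaleR ((norm m)\<^sup>2) 1 + adj z * z)"
    by (rule cinvertible_scaleR_plus_swap[rotated]) (use nm in simp)
  then show False using not_cinvertible_norm_square[OF m] z by simp
qed

text \<open>The negative part m of x = y* y satisfies m x = - m^2. Conjugating x by a root n of m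
  exhibits (y n)* (y n) as minus a square, which forces y n = 0 and then m = 0.\<close>

lemma sa_square_adj_mult_self: "sa_square (adj y * (y::'a::cstar_algebra))"
proof -
  define x where "x = adj y * y"
  have x: "selfadjoint x" by (simp add: x_def)
  \<comment> \<open>Square roots of the positive and negative parts: then n = h(x) is self-adjoint
    with n^2 = m, and once m = 0 the root of x is p(x).\<close>
  define p h where "p t = sqrt (max t 0)" and "h t = sqrt (max (- t) 0)" for t :: real
  have cont: "continuous_on UNIV p" "continuous_on UNIV h"
    unfolding p_def h_def by (intro continuous_intros)+
  have id: "cfc (\<lambda>t. t) x = x" using cfc_poly[OF x, of "[:0, 1:]"] by (simp add: fun_eq_iff cong: cfc_cong)
  have zero: "cfc (\<lambda>t. 0) x = 0" using cfc_poly[OF x, of 0] by (simp cong: cfc_cong)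
  define n where "n = cfc h x"
  define m where "m = n * n"
  have n: "selfadjoint n" unfolding n_def by (rule selfadjoint_cfc[OF x cont(2)])
  then have m: "selfadjoint m" by (simp add: m_def)
  have nx: "x * n = n * x" unfolding n_def by (rule cfc_commute[OF x cont(2)]) simp
  have hh: "cfc (\<lambda>t. h t * h t) x = m"
    unfolding m_def n_def by (rule cfc_mult[OF x cont(2) cont(2)])
  have chh: "continuous_on UNIV (\<lambda>t. h t * h t)" by (intro continuous_intros cont)
  have "m * x = cfc (\<lambda>t. h t * h t * t) x"
    using cfc_mult[OF x chh, of "\<lambda>t. t"] hh id by simp
  also have "(\<lambda>t. h t * h t * t) = (\<lambda>t. 0 - (h t * h t) * (h t * h t))"
    by (auto simp: h_def max_def fun_eq_iff)
  also have "cfc \<dots> x = - (m * m)"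
    using cfc_diff[OF x, of "\<lambda>t. 0" "\<lambda>t. (h t * h t) * (h t * h t)"] cfc_mult[OF x chh chh] hh zero
      continuous_on_mult[OF chh chh] by simp
  finally have mx: "m * x = - (m * m)" .
  have "adj (y * n) * (y * n) = n * (x * n)"
    using n by (simp add: adj_mult selfadjoint_def x_def mult.assoc)
  also have "\<dots> = m * x" by (simp add: nx m_def mult.assoc)
  finally have yn: "y * n = 0" using eq_0_if_adj_mult_self_neg_square[OF m] mx by metis
  then have "m * x = 0" by (simp add: m_def mult.assoc flip: nx) (simp add: x_def mult.assoc)
  then have "norm (m * m) = 0" using mx by simp
  then have m0: "m = 0" using m by (simp add: norm_selfadjoint_square)
  have "(\<lambda>t. t) = (\<lambda>t. p t * p t - h t * h t)"
    by (auto simp: p_def h_def max_def fun_eq_iff)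
  then have "x = cfc (\<lambda>t. p t * p t - h t * h t) x" using id by simp
  also have "\<dots> = cfc p x * cfc p x"
    using cfc_diff[OF x continuous_on_mult[OF cont(1) cont(1)] chh] cfc_mult[OF x cont(1) cont(1)]
      hh m0 by simp
  finally have "x = cfc p x * cfc p x" .
  then show ?thesis using selfadjoint_cfc[OF x cont(1)] unfolding sa_square_def x_def by blast
qed

lemma positive_elem_iff_sa_square: "positive_elem x \<longleftrightarrow> sa_square x"
  unfolding positive_elem_def
  by (metis sa_square_adj_mult_self sa_square_def selfadjoint_def)

text \<open>Cancellation for elements of B whose vanishing is known only after multiplication by
  elements of B.\<close>

lemma eq_0_if_adj_mult_self_squared_eq_0:
  fixes k :: "'a::cstar_algebra"
  assumes "adj k * k * adj k * k = 0" shows "k = 0"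
proof -
  have "norm ((adj k * k) * (adj k * k)) = 0" using assms by (simp add: mult.assoc)
  then have "norm (adj k * k) = 0" by (simp only: norm_selfadjoint_square[OF selfadjoint_adj_mult]) simp
  then show ?thesis by (simp add: cstar_identity)
qed

text \<open>The inverse is a conjugate of p, namely v = v* p v.\<close>

lemma sa_square_inverse:
  fixes p :: "'a::cstar_algebra"
  assumes "sa_square p" "p * v = 1" "v * p = 1"
  shows "sa_square v"
proof -
  have "adj v * p = 1"
    using arg_cong[OF assms(2), of adj] sa_square_selfadjoint[OF assms(1)]
    by (simp add: adj_mult selfadjoint_def)
  then have "adj v * p * v = v" by simp
  then show ?thesis using sa_square_conj[OF assms(1), of v] sa_square_adj_mult_self by metis
qed

text \<open>For \<open>p = s A A\<close> and \<open>w = s A C\<close>, positivity of \<open>s z z\<close> for \<open>z = C (p + \<epsilon>) - A w\<close> gives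
  \<open>(p q + \<epsilon> q - w\<^sup>* w) (p + \<epsilon>) \<ge> 0\<close>, and \<open>p + \<epsilon>\<close> is invertible.\<close>

lemma hermitian_form_Cauchy_Schwarz:
  fixes s :: "'a::cstar_algebra \<Rightarrow> 'a \<Rightarrow> 'a"
  assumes comm: "\<And>X Y X' Y'. s X Y * s X' Y' = s X' Y' * s X Y"
    and add: "\<And>X Y Z. s X (Y + Z) = s X Y + s X Z"
    and scaleR: "\<And>X Y r. s X (scaleR r Y) = scaleR r (s X Y)"
    and mult: "\<And>X Y X' Y'. s X (Y * s X' Y') = s X Y * s X' Y'"
    and adj: "\<And>X Y. adj (s X Y) = s Y X"
    and pos: "\<And>X. sa_square (s X X)"
  shows "sa_square (s A A * s C C - cabs2 (s A C))"
proof -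
  define p q w where "p = s A A" and "q = s C C" and "w = s A C"
  have aw: "adj w = s C A" by (simp add: w_def adj)
  have sp: "sa_square p" "sa_square q" by (simp_all add: p_def q_def pos)
  then have sa: "adj p = p" "adj q = q" using sa_square_selfadjoint by (auto simp: selfadjoint_def)
  have co: "q * p = p * q" "w * p = p * w" "adj w * p = p * adj w" "w * q = q * w"
    "adj w * q = q * adj w" "w * adj w = adj w * w"
    unfolding aw unfolding p_def q_def w_def by (rule comm)+
  have diff: "s X (Y - Z) = s X Y - s X Z" for X Y Z
    using add[of X "Y - Z" Z] by (simp add: algebra_simps)
  have main: "sa_square (p * q + scaleR e q - adj w * w)" if e: "e > 0" for e
  proof -
    define d where "d = p * q + scaleR e q - adj w * w"
    define P where "P = p + scaleR e 1"
    define z where "z = C * p + scaleR e C - A * w"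
    have sz: "s X z = s X C * p + scaleR e (s X C) - s X A * w" for X
      unfolding z_def diff add scaleR unfolding p_def w_def mult ..
    have "s C z = d" using sz[of C] by (simp add: d_def co flip: q_def aw)
    then have zC: "s z C = d"
      using adj[of C z] by (simp add: d_def adj_add adj_diff adj_mult adj_adj sa co)
    have "s A z = scaleR e w" using sz[of A] by (simp add: co flip: p_def w_def)
    then have zA: "s z A = scaleR e (adj w)" using adj[of A z] by simp
    have "s z z + scaleR e (adj w * w) = d * P"
      unfolding sz[of z] zC zA P_def by (simp add: algebra_simps)
    \<comment> \<open>The extra positive term e w* w is exactly what makes the expression factor as
      d P.\<close>
    moreover have "sa_square (s z z + scaleR e (adj w * w))"
      using e by (intro sa_square_add sa_square_scaleR pos sa_square_adj_mult_self) simp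
    ultimately have dP: "sa_square (d * P)" by simp
    have "p * d = d * p" unfolding d_def by (simp add: algebra_simps co) (metis co mult.assoc)
    then have Pd: "P * d = d * P" by (simp add: P_def algebra_simps)
    obtain a where "selfadjoint a" "p = a * a" using sp by (auto simp: sa_square_def)
    then have "cinvertible P" using cinvertible_square_plus[OF _ e] by (simp add: P_def)
    then obtain v where v: "P * v = 1" "v * P = 1" by (auto simp: cinvertible_def)
    have "sa_square P" unfolding P_def using e by (intro sa_square_add sa_square_scaleR sp) simp_all
    then have sv: "sa_square v" using v by (rule sa_square_inverse)
    \<comment> \<open>The inverse v of P is positive and commutes with d P, so d = (d P) v is a
      product of commuting positive elements.\<close>
    have "v * d = v * (d * P) * v" by (simp add: mult.assoc v)
    also have "\<dots> = v * P * d * v" by (simp add: Pd[symmetric] mult.assoc)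
    finally have "v * d = d * v" by (simp add: v)
    then have "(d * P) * v = v * (d * P)" using v by (metis Pd mult.assoc mult_1_left mult_1_right)
    then have "sa_square ((d * P) * v)" by (rule sa_square_mult[OF dP sv])
    then show ?thesis by (simp add: mult.assoc v d_def)
  qed
  have "(\<lambda>n. p * q + scaleR (inverse (real (Suc n))) q - adj w * w) \<longlonglongrightarrow> p * q + scaleR 0 q - adj w * w"
    by (intro tendsto_intros LIMSEQ_inverse_real_of_nat)
  then have "sa_square (p * q + scaleR 0 q - adj w * w)"
    by (rule sa_square_lim) (rule main, simp)
  then show ?thesis by (simp add: p_def q_def w_def cabs2_def)
qed

section \<open>Tracial conditional expectations\<close>

locale tracial_conditional_expectation =
  fixes E :: "'a::cstar_algebra \<Rightarrow> 'a" and B :: "'a set"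
  assumes subalgebra: "cstar_subalgebra B" and cond_exp: "cond_exp E B" and tracial: "tracial E"
begin

lemma
  shows in_B: "E x \<in> B" and add: "E (x + y) = E x + E y" and cscale: "E (cscale z x) = cscale z (E x)"
    and norm_le: "norm (E x) \<le> norm x"
    and module: "b \<in> B \<Longrightarrow> c \<in> B \<Longrightarrow> E (b * x * c) = b * E x * c"
  using cond_exp by (auto simp: cond_exp_def)

lemma trace: "E (x * y) = E (y * x)"
  using tracial by (auto simp: tracial_def)

lemma scaleR: "E (scaleR r x) = scaleR r (E x)"
  using cscale[of "of_real r" x] by (simp add: cscale_of_real)

lemma bounded_linear: "bounded_linear E"
  by (rule bounded_linear_intro[where K = 1]) (simp_all add: add scaleR norm_le)

lemmas diff = linear_diff[OF bounded_linear.linear[OF bounded_linear]]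
lemmas sum = linear_sum[OF bounded_linear.linear[OF bounded_linear]]
lemmas tendsto = bounded_linear.tendsto[OF bounded_linear]

lemma B_closed:
  "b \<in> B \<Longrightarrow> c \<in> B \<Longrightarrow> b + c \<in> B" "b \<in> B \<Longrightarrow> c \<in> B \<Longrightarrow> b * c \<in> B"
  "b \<in> B \<Longrightarrow> cscale z b \<in> B" "b \<in> B \<Longrightarrow> adj b \<in> B"
  using subalgebra by (auto simp: cstar_subalgebra_def)

lemma B_diff: "b \<in> B \<Longrightarrow> c \<in> B \<Longrightarrow> b - c \<in> B"
  using B_closed(1)[of b "- c"] B_closed(3)[of c "- 1"] by simp

text \<open>Traciality makes triple products from \<open>B\<close> central in \<open>B\<close>, hence annihilators of commutators.\<close>

lemma B_commute:
  assumes a: "a \<in> B" and c: "c \<in> B" shows "a * c = c * a"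
proof -
  have central: "(b * y * v) * d = d * (b * y * v)"
    if B: "b \<in> B" "y \<in> B" "v \<in> B" "d \<in> B" for b y v d
  proof -
    obtain x where x: "y = E x" using B(2) cond_exp by (auto simp: cond_exp_def)
    have "b * E x * (v * d) = E (b * x * (v * d))" by (intro module[symmetric] B B_closed)
    also have "\<dots> = E (d * (b * x * v))" using trace[of "b * x * v" d] by (simp add: mult.assoc)
    also have "\<dots> = E ((d * b) * x * v)" by (simp add: mult.assoc)
    also have "\<dots> = (d * b) * E x * v" by (intro module B B_closed)
    finally show ?thesis by (simp add: x mult.assoc)
  qed
  define k where "k = a * c - c * a"
  have k: "k \<in> B" "adj k \<in> B" by (simp_all add: k_def a c B_closed B_diff)
  \<comment> \<open>Both \<open>w\<close> and \<open>w * a\<close> are triple products from B, so w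
    a c = c w a = w c a. Hence w k = 0, that is, (k* k)^2 = 0.\<close>
  define w where "w = adj k * k * adj k"
  have "w * a * c = c * (w * a)"
    using central[of "adj k" k "adj k * a" c] by (simp add: w_def mult.assoc k a c B_closed)
  also have "\<dots> = w * c * a"
    using central[of "adj k" k "adj k" c] by (simp add: w_def mult.assoc[symmetric] k c)
  finally have "w * k = 0" by (simp add: k_def right_diff_distrib mult.assoc)
  then have "k = 0" unfolding w_def by (rule eq_0_if_adj_mult_self_squared_eq_0)
  then show ?thesis by (simp add: k_def)
qed

text \<open>The module rule needs factors from B on both sides. Sandwiching the defect d between two
  copies of d*, which lies in B, gives d* d d* = 0.\<close>

lemma mult_left:
  assumes b: "b \<in> B" shows "E (b * x) = b * E x"
proof -
  define d where "d = E (b * x) - b * E x"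
  have d: "adj d \<in> B" by (simp add: d_def b in_B B_closed B_diff)
  have "adj d * E (b * x) * adj d = E ((adj d * b) * x * adj d)"
    using module[OF d d, of "b * x"] by (simp add: mult.assoc)
  also have "\<dots> = (adj d * b) * E x * adj d" by (intro module d b B_closed)
  finally have "adj d * d * adj d = 0" by (simp add: d_def algebra_simps)
  then have "adj d * d * adj d * d = 0" by simp
  then have "d = 0" by (rule eq_0_if_adj_mult_self_squared_eq_0)
  then show ?thesis by (simp add: d_def)
qed

lemma mult_right: "b \<in> B \<Longrightarrow> E (x * b) = E x * b"
  using mult_left[of b x] B_commute[of b "E x"] in_B[of x] by (simp add: trace[of x b])

lemma sa_square: "sa_square x \<Longrightarrow> sa_square (E x)"
  using cond_exp by (simp add: cond_exp_def flip: positive_elem_iff_sa_square)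

text \<open>Write x = N - (N - x) with N = norm x, a difference of positive elements, whose images
  are positive.\<close>

lemma selfadjoint:
  assumes x: "selfadjoint x" shows "selfadjoint (E x)"
proof -
  define N where "N = norm x"
  have "norm (scaleR N 1 - (scaleR N 1 - x)) \<le> N" by (simp add: N_def)
  then have "sa_square (scaleR N 1 - x)" using x unfolding sa_square_iff_norm by (metis selfadjoint_arith(2,4,6))
  then have "selfadjoint (E (scaleR N 1) - E (scaleR N 1 - x))"
    by (intro selfadjoint_arith(4) sa_square_selfadjoint sa_square sa_square_scaleR)
       (simp_all add: N_def)
  then show ?thesis by (simp add: diff)
qed

lemma adj: "E (adj x) = adj (E x)"
proof -
  obtain a b where ab: "selfadjoint a" "selfadjoint b" "x = a + cscale \<i> b" "adj x = a - cscale \<i> b"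
    by (rule cartesian_decomposition)
  have "adj (E a) = E a" "adj (E b) = E b" using ab selfadjoint by (auto simp: selfadjoint_def)
  then show ?thesis unfolding ab(4) unfolding ab(3)
    by (simp add: add diff cscale adj_add adj_cscale cscale_minus_left)
qed

section \<open>The symmetrized sesquilinear form\<close>

lemma double_sum:
  "E (sum u I * X * sum v J * Y) = (\<Sum>k\<in>I. \<Sum>l\<in>J. E (u k * X * v l * Y))"
  by (simp add: sum_distrib_left sum_distrib_right sum) (rule sum.swap)

text \<open>With u = r^2 and v = t^2, moving one r around the trace turns the argument into (t X r)*
  (t X r).\<close>

lemma sa_square_sandwich:
  assumes "sa_square u" "sa_square v" shows "sa_square (E (u * adj X * v * X))"
proof -
  obtain r t where "selfadjoint r" "u = r * r" "selfadjoint t" "v = t * t"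
    using assms by (auto simp: sa_square_def)
  then have "E (u * adj X * v * X) = E (adj (t * X * r) * (t * X * r))"
    using trace[of r "r * adj X * v * X"] by (simp add: selfadjoint_def adj_mult mult.assoc)
  then show ?thesis by (simp add: sa_square sa_square_adj_mult_self)
qed

text \<open>Twice the symmetric correlation if \<open>H = F G\<close>; kept separate because the Bernstein approximant
  of a product is not the product of the approximants.\<close>

definition sym_corr :: "'a \<Rightarrow> 'a \<Rightarrow> 'a \<Rightarrow> 'a \<Rightarrow> 'a \<Rightarrow> 'a" where
  "sym_corr H F G X Y = E (H * adj X * Y) - E (F * adj X * G * Y) + (E (H * Y * adj X) - E (F * Y * G * adj X))"

text \<open>Symmetrization turns \<open>\<alpha> k * \<beta> k - \<alpha> k * \<beta> l\<close> into \<open>(\<alpha> k - \<alpha> l) * (\<beta> k - \<beta> l)\<close>.\<close>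

lemma sym_corr_finite_spectrum:
  assumes u: "sum u I = 1"
  shows "sym_corr (\<Sum>k\<in>I. scaleR (\<alpha> k * \<beta> k) (u k)) (\<Sum>k\<in>I. scaleR (\<alpha> k) (u k))
      (\<Sum>k\<in>I. scaleR (\<beta> k) (u k)) X Y
    = (\<Sum>k\<in>I. \<Sum>l\<in>I. scaleR ((\<alpha> k - \<alpha> l) * (\<beta> k - \<beta> l)) (E (u k * adj X * u l * Y)))"
proof -
  define a where "a k l = E (u k * adj X * u l * Y)" for k l
  have a': "E (u k * Y * u l * adj X) = a l k" for k l
    using trace[of "u k * Y" "u l * adj X"] by (simp add: a_def mult.assoc)
  define H F G where "H = (\<Sum>k\<in>I. scaleR (\<alpha> k * \<beta> k) (u k))" and
    "F = (\<Sum>k\<in>I. scaleR (\<alpha> k) (u k))" and "G = (\<Sum>k\<in>I. scaleR (\<beta> k) (u k))"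
  \<comment> \<open>Inserting the unit as the sum of all u l between the factors gives this term the
    same double-sum shape as the terms with G in the middle.\<close>
  have 1: "E (H * adj X * Y) = (\<Sum>k\<in>I. \<Sum>l\<in>I. scaleR (\<alpha> k * \<beta> k) (a k l))"
    using double_sum[of "\<lambda>k. scaleR (\<alpha> k * \<beta> k) (u k)" I "adj X" u I Y]
    by (simp add: u scaleR a_def H_def)
  have 2: "E (F * adj X * G * Y) = (\<Sum>k\<in>I. \<Sum>l\<in>I. scaleR (\<alpha> k * \<beta> l) (a k l))"
    using double_sum[of "\<lambda>k. scaleR (\<alpha> k) (u k)" I "adj X" "\<lambda>k. scaleR (\<beta> k) (u k)" I Y]
    by (simp add: scaleR a_def F_def G_def mult.commute)
  have 3: "E (H * Y * adj X) = (\<Sum>k\<in>I. \<Sum>l\<in>I. scaleR (\<alpha> l * \<beta> l) (a k l))"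
    using double_sum[of "\<lambda>k. scaleR (\<alpha> k * \<beta> k) (u k)" I Y u I "adj X"]
    by (simp add: u scaleR a' H_def) (rule sum.swap)
  have 4: "E (F * Y * G * adj X) = (\<Sum>k\<in>I. \<Sum>l\<in>I. scaleR (\<alpha> l * \<beta> k) (a k l))"
    using double_sum[of "\<lambda>k. scaleR (\<alpha> k) (u k)" I Y "\<lambda>k. scaleR (\<beta> k) (u k)" I "adj X"]
    by (simp add: scaleR a' F_def G_def mult.commute) (rule sum.swap)
  have "sym_corr H F G X Y = (\<Sum>k\<in>I. \<Sum>l\<in>I. scaleR (\<alpha> k * \<beta> k) (a k l) - scaleR (\<alpha> k * \<beta> l) (a k l)
      + (scaleR (\<alpha> l * \<beta> l) (a k l) - scaleR (\<alpha> l * \<beta> k) (a k l)))"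
    unfolding sym_corr_def 1 2 3 4 by (simp only: sum.distrib sum_subtractf)
  also have "\<dots> = (\<Sum>k\<in>I. \<Sum>l\<in>I. scaleR ((\<alpha> k - \<alpha> l) * (\<beta> k - \<beta> l)) (a k l))"
    by (intro sum.cong refl) (simp add: algebra_simps)
  finally show ?thesis by (simp only: H_def F_def G_def a_def)
qed

text \<open>For the approximants, same monotonicity makes every coefficient nonnegative, and limits
  preserve positivity. The nodes may lie outside the spectrum, hence monotonicity on the whole
  line.\<close>

lemma sa_square_sym_corr:
  assumes \<rho>: "selfadjoint \<rho>" and f: "continuous_on UNIV f" and g: "continuous_on UNIV g"
    and mono: "same_monotonic f g UNIV"
  shows "sa_square (sym_corr (cfc f \<rho> * cfc g \<rho>) (cfc f \<rho>) (cfc g \<rho>) X X)"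
proof -
  obtain u \<tau> where u: "\<And>n k. sa_square (u n k)" "\<And>n. (\<Sum>k\<le>n. u n k) = 1"
    and lim: "\<And>f. continuous_on UNIV f \<Longrightarrow> (\<lambda>n. \<Sum>k\<le>n. scaleR (f (\<tau> n k)) (u n k)) \<longlonglongrightarrow> cfc f \<rho>"
    using bernstein_cfc[OF \<rho>] by blast
  have limH: "(\<lambda>n. \<Sum>k\<le>n. scaleR (f (\<tau> n k) * g (\<tau> n k)) (u n k)) \<longlonglongrightarrow> cfc f \<rho> * cfc g \<rho>"
    using lim[OF continuous_on_mult[OF f g]] cfc_mult[OF \<rho> f g] by simp
  have "(\<lambda>n. sym_corr (\<Sum>k\<le>n. scaleR (f (\<tau> n k) * g (\<tau> n k)) (u n k)) (\<Sum>k\<le>n. scaleR (f (\<tau> n k)) (u n k))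
      (\<Sum>k\<le>n. scaleR (g (\<tau> n k)) (u n k)) X X)
      \<longlonglongrightarrow> sym_corr (cfc f \<rho> * cfc g \<rho>) (cfc f \<rho>) (cfc g \<rho>) X X"
    unfolding sym_corr_def by (intro tendsto_intros tendsto limH lim f g)
  then show ?thesis
  proof (rule sa_square_lim)
    fix n
    show "sa_square (sym_corr (\<Sum>k\<le>n. scaleR (f (\<tau> n k) * g (\<tau> n k)) (u n k))
        (\<Sum>k\<le>n. scaleR (f (\<tau> n k)) (u n k)) (\<Sum>k\<le>n. scaleR (g (\<tau> n k)) (u n k)) X X)"
      unfolding sym_corr_finite_spectrum[OF u(2)] using mono
      by (intro sa_square_sum sa_square_scaleR sa_square_sandwich u(1)) (simp add: same_monotonic_def)
  qed
qed

lemma sym_corr_Cauchy_Schwarz: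
  assumes F: "selfadjoint F" and G: "selfadjoint G" and FG: "F * G = G * F"
    and pos: "\<And>X. sa_square (sym_corr (F * G) F G X X)"
  shows "sa_square (sym_corr (F * G) F G X X * sym_corr (F * G) F G Y Y - cabs2 (sym_corr (F * G) F G X Y))"
proof (rule hermitian_form_Cauchy_Schwarz)
  have in_B': "sym_corr (F * G) F G X Y \<in> B" for X Y
    by (simp add: sym_corr_def B_diff B_closed in_B)
  show "sym_corr (F * G) F G X Y * sym_corr (F * G) F G X' Y' = sym_corr (F * G) F G X' Y' * sym_corr (F * G) F G X Y"
    for X Y X' Y' by (intro B_commute in_B')
  show "sym_corr (F * G) F G X (Y + Z) = sym_corr (F * G) F G X Y + sym_corr (F * G) F G X Z" for X Y Z
    by (simp add: sym_corr_def algebra_simps add)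
  show "sym_corr (F * G) F G X (scaleR r Y) = scaleR r (sym_corr (F * G) F G X Y)" for X Y r
    by (simp add: sym_corr_def algebra_simps scaleR)
  have mult: "sym_corr (F * G) F G X (Y * b) = sym_corr (F * G) F G X Y * b" if b: "b \<in> B" for X Y b
  proof -
    have 1: "E (Z * (Y * b)) = E (Z * Y) * b" for Z
      using mult_right[OF b, of "Z * Y"] by (simp add: mult.assoc)
    \<comment> \<open>Here b sits in the interior; rotating W to the front puts b last, where 1
      applies.\<close>
    have 2: "E (Z * (Y * b) * W) = E (Z * Y * W) * b" for Z W
    proof -
      have "E (Z * (Y * b) * W) = E (W * Z * (Y * b))"
        using trace[of "Z * (Y * b)" W] by (simp add: mult.assoc)
      also have "\<dots> = E (W * (Z * Y)) * b" using 1[of "W * Z"] by (simp add: mult.assoc)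
      finally show ?thesis by (simp only: trace[of W "Z * Y"])
    qed
    have 3: "E (F * (Y * b) * G * adj X) = E (F * Y * G * adj X) * b"
      using 2[of F "G * adj X"] by (simp add: mult.assoc)
    show ?thesis unfolding sym_corr_def 1 2 3 by (simp add: left_diff_distrib distrib_right)
  qed
  show "sym_corr (F * G) F G X (Y * sym_corr (F * G) F G X' Y') = sym_corr (F * G) F G X Y * sym_corr (F * G) F G X' Y'"
    for X Y X' Y' by (intro mult in_B')
  have sa: "adj F = F" "adj G = G" using F G by (simp_all add: selfadjoint_def)
  have a1: "adj (E (F * G * V * W)) = E (F * G * adj W * adj V)" for V W
  proof -
    have "adj (E (F * G * V * W)) = E ((adj W * adj V) * (G * F))"
      by (simp add: adj[symmetric] adj_mult sa mult.assoc)
    also have "\<dots> = E ((F * G) * (adj W * adj V))" unfolding FG by (rule trace)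
    finally show ?thesis by (simp add: mult.assoc)
  qed
  have a2: "adj (E (F * V * G * W)) = E (F * adj W * G * adj V)" for V W
  proof -
    have "adj (E (F * V * G * W)) = E ((adj W * G * adj V) * F)"
      by (simp add: adj[symmetric] adj_mult sa mult.assoc)
    also have "\<dots> = E (F * (adj W * G * adj V))" by (rule trace)
    finally show ?thesis by (simp add: mult.assoc)
  qed
  show "adj (sym_corr (F * G) F G X Y) = sym_corr (F * G) F G Y X" for X Y
    by (simp add: sym_corr_def adj_add adj_diff a1 a2 adj_adj)
qed (rule pos)

end

section \<open>Correlation and skew information\<close>

context tracial_conditional_expectation begin

lemma SymCorr_eq_sym_corr:
  "SymCorr f g \<rho> E X Y = scaleR (1/2) (sym_corr (cfc f \<rho> * cfc g \<rho>) (cfc f \<rho>) (cfc g \<rho>) X Y)"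
  by (simp add: SymCorr_def Corr_def sym_corr_def adj_adj)

lemma SymCorr_Cauchy_Schwarz:
  assumes \<rho>: "selfadjoint \<rho>" and f: "continuous_on UNIV f" and g: "continuous_on UNIV g"
    and mono: "same_monotonic f g UNIV"
  shows "cle (cabs2 (SymCorr f g \<rho> E X Y)) (SymCorr f g \<rho> E X X * SymCorr f g \<rho> E Y Y)"
proof -
  define s where "s = sym_corr (cfc f \<rho> * cfc g \<rho>) (cfc f \<rho>) (cfc g \<rho>)"
  have "cfc f \<rho> * cfc g \<rho> = cfc g \<rho> * cfc f \<rho>"
    by (intro cfc_commute[OF \<rho> g] cfc_commute[OF \<rho> f, symmetric]) simp
  then have "sa_square (s X X * s Y Y - cabs2 (s X Y))"
    unfolding s_def
    by (intro sym_corr_Cauchy_Schwarz selfadjoint_cfc \<rho> f g sa_square_sym_corr mono)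
  \<comment> \<open>Both terms are quadratic in s, and \<open>SymCorr\<close> is s / 2.\<close>
  then have "sa_square (scaleR (1/4) (s X X * s Y Y - cabs2 (s X Y)))"
    by (rule sa_square_scaleR[rotated]) simp
  then show ?thesis
    by (simp add: cle_def positive_elem_iff_sa_square SymCorr_eq_sym_corr cabs2_def scaleR_diff_right
        flip: s_def)
qed

text \<open>Taking adjoints reverses the products and the trace brings f(\<rho>) back to the front.
  For self-adjoint arguments the symmetric correlation is therefore the real part of the
  correlation.\<close>

lemma Corr_adj:
  assumes "selfadjoint (cfc f \<rho>)" "selfadjoint (cfc g \<rho>)" "cfc f \<rho> * cfc g \<rho> = cfc g \<rho> * cfc f \<rho>"
  assumes X: "selfadjoint X" and Y: "selfadjoint Y"
  shows "adj (Corr f g \<rho> E X Y) = Corr f g \<rho> E Y X"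
proof -
  define F G where "F = cfc f \<rho>" and "G = cfc g \<rho>"
  have sa: "adj F = F" "adj G = G" "adj X = X" "adj Y = Y" and FG: "F * G = G * F"
    using assms by (auto simp: selfadjoint_def F_def G_def)
  have "adj (Corr f g \<rho> E X Y) = E ((Y * X) * (G * F)) - E ((Y * G * X) * F)"
    by (simp add: Corr_def adj_diff adj[symmetric] adj_mult sa mult.assoc flip: F_def G_def)
  also have "\<dots> = E ((F * G) * (Y * X)) - E (F * (Y * G * X))"
    unfolding FG by (simp only: trace[of "Y * X"] trace[of "Y * G * X"])
  also have "\<dots> = Corr f g \<rho> E Y X"
    by (simp add: Corr_def sa mult.assoc flip: F_def G_def)
  finally show ?thesis .
qed

text \<open>Replacing X by X* leaves the first term of the correlation unchanged by normality, and
  the second by traciality, since the same f(\<rho>) occurs twice.\<close>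

lemma SkewI_normal:
  assumes "normal_elem X"
  shows "SkewI f f \<rho> E X = SymCorr f f \<rho> E X X"
proof -
  define F where "F = cfc f \<rho>"
  have n: "adj X * X = X * adj X" using assms by (simp add: normal_elem_def)
  have "E (F * F * adj X * X) = E (F * F * X * adj X)" by (simp add: mult.assoc n)
  moreover have "E (F * adj X * F * X) = E (F * X * F * adj X)"
    using trace[of "F * adj X" "F * X"] by (simp add: mult.assoc)
  ultimately have "Corr f f \<rho> E X X = Corr f f \<rho> E (adj X) (adj X)"
    by (simp add: Corr_def adj_adj flip: F_def)
  then show ?thesis by (simp add: SkewI_def SymCorr_def scaleR_half_double)
qed

end

lemma SkewI_selfadjoint:
  "selfadjoint X \<Longrightarrow> SkewI f g \<rho> E X = SymCorr f g \<rho> E X X"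
  by (simp add: SkewI_def SymCorr_def selfadjoint_def scaleR_half_double)

text \<open>Clamping the argument to the convex hull of the spectrum extends \<open>f\<close> and \<open>g\<close> to the whole
  line without changing the functional calculus.\<close>

lemma same_monotonic_extension:
  fixes x :: "'a::cstar_algebra" and f g :: "real \<Rightarrow> real"
  assumes x: "selfadjoint x" and D: "is_interval D" "rspec x \<subseteq> D"
    and f: "continuous_on D f" and g: "continuous_on D g" and mono: "same_monotonic f g D"
  obtains c where "continuous_on UNIV (f \<circ> c)" "continuous_on UNIV (g \<circ> c)"
    "same_monotonic (f \<circ> c) (g \<circ> c) UNIV" "cfc (f \<circ> c) x = cfc f x" "cfc (g \<circ> c) x = cfc g x"
proof -
  obtain a where a: "a \<in> rspec x" "\<And>t. t \<in> rspec x \<Longrightarrow> a \<le> t"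
    using compact_attains_inf[OF compact_rspec rspec_nonempty[OF x]] by blast
  obtain b where b: "b \<in> rspec x" "\<And>t. t \<in> rspec x \<Longrightarrow> t \<le> b"
    using compact_attains_sup[OF compact_rspec rspec_nonempty[OF x]] by blast
  define c where "c t = max a (min b t)" for t
  have cont: "continuous_on UNIV c" unfolding c_def by (intro continuous_intros)
  have "a \<le> b" using a b by blast
  then have "a \<le> c t" "c t \<le> b" for t by (auto simp: c_def)
  then have cD: "c t \<in> D" for t
    using D a(1) b(1) mem_is_interval_1_I[OF D(1), of a b "c t"] by blast
  have id: "c t = t" if "t \<in> rspec x" for t using a(2)[OF that] b(2)[OF that] by (simp add: c_def)
  show ?thesis
  proof (rule that[of c])
    show "continuous_on UNIV (f \<circ> c)" "continuous_on UNIV (g \<circ> c)"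
      unfolding o_def using cD
      by (auto intro: continuous_on_compose2[OF f cont] continuous_on_compose2[OF g cont])
    show "same_monotonic (f \<circ> c) (g \<circ> c) UNIV" using mono cD by (auto simp: same_monotonic_def)
    show "cfc (f \<circ> c) x = cfc f x" "cfc (g \<circ> c) x = cfc g x" by (auto intro!: cfc_cong simp: id)
  qed
qed

theorem theorem4p6:
  fixes E :: "'a::cstar_algebra \<Rightarrow> 'a" and \<B> :: "'a set" and \<rho> :: 'a
    and f g :: "real \<Rightarrow> real" and D :: "real set"
  assumes "cstar_subalgebra \<B>"
    and "cond_exp E \<B>" and "tracial E"
    and "positive_elem \<rho>"
    and "is_interval D" and "cspectrum \<rho> \<subseteq> complex_of_real ` D"
    and "continuous_on D f" and "continuous_on D g"
    and "same_monotonic f g D"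
  shows "(\<forall>A B. selfadjoint A \<and> selfadjoint B \<longrightarrow>
            cabs2 (SymCorr f g \<rho> E A B) = cabs2 (creal (Corr f g \<rho> E A B)) \<and>
            cle (cabs2 (creal (Corr f g \<rho> E A B))) (SkewI f g \<rho> E A * SkewI f g \<rho> E B))
      \<and> (f = g \<longrightarrow> (\<forall>A B. normal_elem A \<and> normal_elem B \<longrightarrow>
            cle (cabs2 (SymCorr f g \<rho> E A B)) (SkewI f g \<rho> E A * SkewI f g \<rho> E B)))"
proof -
  interpret tracial_conditional_expectation E \<B>
    by unfold_locales (fact assms)+
  have \<rho>: "selfadjoint \<rho>"
    using assms(4) by (simp add: positive_elem_iff_sa_square sa_square_selfadjoint)
  have "rspec \<rho> \<subseteq> D" using assms(6) by (auto simp: rspec_def)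
  then obtain c where c: "continuous_on UNIV (f \<circ> c)" "continuous_on UNIV (g \<circ> c)"
      "same_monotonic (f \<circ> c) (g \<circ> c) UNIV"
    and cfc: "cfc (f \<circ> c) \<rho> = cfc f \<rho>" "cfc (g \<circ> c) \<rho> = cfc g \<rho>"
    using same_monotonic_extension[OF \<rho> assms(5) _ assms(7-9)] by metis
  \<comment> \<open>The correlations see f and g only through \<open>cfc\<close>, so the inequality
    for the clamped functions is already the one for f and g.\<close>
  have CS: "cle (cabs2 (SymCorr f g \<rho> E X Y)) (SymCorr f g \<rho> E X X * SymCorr f g \<rho> E Y Y)" for X Y
    using SymCorr_Cauchy_Schwarz[OF \<rho> c] by (simp add: SymCorr_eq_sym_corr cfc)
  have sa: "selfadjoint (cfc f \<rho>)" "selfadjoint (cfc g \<rho>)"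
    using selfadjoint_cfc[OF \<rho> c(1)] selfadjoint_cfc[OF \<rho> c(2)] by (simp_all add: cfc)
  have "cfc (f \<circ> c) \<rho> * cfc (g \<circ> c) \<rho> = cfc (g \<circ> c) \<rho> * cfc (f \<circ> c) \<rho>"
    by (intro cfc_commute[OF \<rho> c(2)] cfc_commute[OF \<rho> c(1), symmetric]) simp
  then have comm: "cfc f \<rho> * cfc g \<rho> = cfc g \<rho> * cfc f \<rho>" by (simp add: cfc)
  have Re: "SymCorr f g \<rho> E X Y = creal (Corr f g \<rho> E X Y)"
    if "selfadjoint X" "selfadjoint Y" for X Y
    using Corr_adj[OF sa comm that] that by (simp add: SymCorr_def creal_def selfadjoint_def)
  show ?thesis
  proof (intro conjI allI impI; elim conjE)
    fix X Y :: 'a assume "selfadjoint X" "selfadjoint Y"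
    then show "cabs2 (SymCorr f g \<rho> E X Y) = cabs2 (creal (Corr f g \<rho> E X Y))"
      and "cle (cabs2 (creal (Corr f g \<rho> E X Y))) (SkewI f g \<rho> E X * SkewI f g \<rho> E Y)"
      using CS[of X Y] by (simp_all add: Re SkewI_selfadjoint)
  next
    fix X Y :: 'a assume "f = g" "normal_elem X" "normal_elem Y"
    then show "cle (cabs2 (SymCorr f g \<rho> E X Y)) (SkewI f g \<rho> E X * SkewI f g \<rho> E Y)"
      using CS[of X Y] by (simp add: SkewI_normal)
  qed
qed

end
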